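(* Let $p$ be a prime and let $\Gamma\subseteq\mathbb{F}_p^*$ be a multiplicative subgroup with $|\Gamma|\le p^{2/3}$. Then $$\mathsf{M}(\Gamma)\ll |\Gamma|^{1/2}p^{1/6}\log^{1/6}|\Gamma| .$$ Further, if $p^{10}\ll |\Gamma|^{22}\,\mathsf{E}(\Gamma)^2\log^{9}|\Gamma|$, then $$\sum_{\xi\neq 0}|\widehat{\Gamma}(\xi)|^{32/5}\ll |\Gamma|^{16/5}\,\mathsf{E}(\Gamma)^{2/5}\,p^{6/5}\log^{9/5}|\Gamma| .$$
   Context: Here $\widehat{\Gamma}(\xi)=\sum_{x\in\Gamma}e^{-2\pi i x\xi/p}$ for $\xi\in\mathbb{F}_p$, $\mathsf{M}(\Gamma)=\max_{\xi\ne0}\big|\sum_{x\in\Gamma}e^{2\pi i x\xi/p}\big|$, and $\mathsf{E}(\Gamma)=|\{(a_1,a_2,b_1,b_2)\in\Gamma^4: a_1+b_1=a_2+b_2\}|$ is the additive energy. Logarithms are base 2; $\ll$ denotes inequality up to an absolute constant (in the hypothesis, with the implied constant in the conclusion depending on the one in the hypothesis).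
   Formalization: The first bound is stated for |Γ| ≥ 2 only: for the trivial subgroup Γ = {1} one has M(Γ) = 1 but log|Γ| = 0, so the bound as written fails there. *)

theory Defs
  imports Complex_Main "HOL-Number_Theory.Residues"
begin

text \<open>The field with \<open>p\<close> elements is \<^term>\<open>residue_ring (int p)\<close>, with carrier
  the integer representatives \<open>0, \<dots>, p - 1\<close>. The exponentials below depend only on the
  residue classes of \<open>x\<close> and \<open>\<xi>\<close>.\<close>

abbreviation GFp :: "nat \<Rightarrow> int ring" where
  "GFp p \<equiv> residue_ring (int p)"

definition fourier :: "nat \<Rightarrow> int set \<Rightarrow> int \<Rightarrow> complex" where
  "fourier p \<Gamma> \<xi> =
     (\<Sum>x\<in>\<Gamma>. exp (- 2 * complex_of_real pi * \<i> * of_int x * of_int \<xi> / of_nat p))"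

definition max_exp_sum :: "nat \<Rightarrow> int set \<Rightarrow> real" where
  "max_exp_sum p \<Gamma> =
     Max ((\<lambda>\<xi>. cmod (\<Sum>x\<in>\<Gamma>. exp (2 * complex_of_real pi * \<i> * of_int x * of_int \<xi> / of_nat p)))
            ` (carrier (GFp p) - {\<zero>\<^bsub>GFp p\<^esub>}))"

definition additive_energy :: "nat \<Rightarrow> int set \<Rightarrow> nat" where
  "additive_energy p \<Gamma> =
     card {(a\<^sub>1, a\<^sub>2, b\<^sub>1, b\<^sub>2). a\<^sub>1 \<in> \<Gamma> \<and> a\<^sub>2 \<in> \<Gamma> \<and> b\<^sub>1 \<in> \<Gamma> \<and> b\<^sub>2 \<in> \<Gamma> \<and>
             a\<^sub>1 \<oplus>\<^bsub>GFp p\<^esub> b\<^sub>1 = a\<^sub>2 \<oplus>\<^bsub>GFp p\<^esub> b\<^sub>2}"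

end

theory Submission
  imports Defs "HOL-Computational_Algebra.Polynomial_Factorial" "HOL-Analysis.Complex_Transcendental"
begin

text \<open>
  Write \<open>t = |\<Gamma>|\<close> and let \<open>E\<^sub>3(Q)\<close> be the third moment of the autocorrelation of \<open>Q\<close>. For a set
  \<open>Q\<close> of nonzero frequencies that is a union of cosets of \<open>\<Gamma>\<close>, the positive semidefinite matrix
  \<open>(\<Sum>u\<in>Q. e(u(x - y)/p))\<close>, \<open>x, y \<in> \<Gamma>\<close>, has the constant vector as an eigenvector, with eigenvalue
  \<open>(\<Sum>u\<in>Q. |\<Gamma>^(u)|\<^sup>2)/t\<close>. The cube of this eigenvalue is at most the trace of the cube of the matrix,
  which by Cauchy-Schwarz and Parseval is at most \<open>p (E\<^sub>3(\<Gamma>) E\<^sub>3(Q))\<^sup>1\<^sup>/\<^sup>2\<close>.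

  The third moments are controlled by Stepanov's method: for unions \<open>Q, Z\<close> of cosets of moderate size
  there are \<open>O((|Q||Z|/t)\<^sup>2\<^sup>/\<^sup>3)\<close> elements \<open>u \<in> Q\<close> with \<open>u - 1 \<in> Z\<close>. This bounds the level sets of
  the correlation of \<open>\<Gamma>\<close> with \<open>Q\<close>, and averaging over the cosets in \<open>Q\<close> bounds \<open>E\<^sub>3(Q)\<close>.

  Taking a single coset for \<open>Q\<close> gives the first claim. Taking for \<open>Q\<close> the frequencies with
  \<open>|\<Gamma>^| \<ge> \<tau>\<close> gives a bound for the twelfth power of \<open>\<tau>\<close> times \<open>|Q|\<close> unless \<open>\<tau>\<close> is small; interpolating
  this with the fourth moment \<open>p E(\<Gamma>)\<close> gives the second claim, and for small \<open>\<tau>\<close> the fourth moment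
  suffices. The hypothesis on \<open>p\<close> serves to compare the resulting powers.
\<close>

section \<open>Integer polynomials modulo a prime\<close>

text \<open>Let q = |Q|. Up to logarithms and secondary terms, E_3(Q) is at most about q^5 / t^2 and
  E_3(\<Gamma>) about t^3, so (\<tau>^2 q / t)^6 \<le> p^2 E_3(\<Gamma>) E_3(Q) turns into a bound
  t^7 p^2 for \<tau>^12 q. For q = t this is the first claim. The exponent 32/5 is 12 * 3/10 + 4 *
  7/10 with weights of sum one, so the powers 3/10 and 7/10 of this bound and of \<tau>^4 q \<le> p
  E(\<Gamma>) multiply to a bound for \<tau>^(32/5) q. The obstacle is that the parameters of
  Stepanov's method can be chosen only if |Q||Z| is small against t^4 and p^3 / t^2. A level set
  that is too large is cut down to a union of cosets of almost the largest admissible size, and the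
  bound for that part forces the level below a threshold of order q (1/t + t/p). Below the threshold
  the first moment of the correlation suffices. This is the origin of the secondary terms, and they
  are the reason why small \<tau> must be treated separately.\<close>

lemma const_dvd_poly_value:
  fixes c x :: int and f :: "int poly"
  assumes "[:c:] dvd f"
  shows "c dvd poly f x"
  using assms by (auto elim!: dvdE)

text \<open>Roots are split off one at a time: at a new root v the product already split off is a
  product of nonzero residues v - u, so the cofactor itself has to vanish at v.\<close>

lemma exists_cofactor_mod_roots:
  fixes p :: int and g :: "int poly"
  assumes "prime p" "finite S" "inj_on (\<lambda>u. u mod p) S" "\<And>u. u \<in> S \<Longrightarrow> p dvd poly g u"
  shows "\<exists>h. [:p:] dvd g - (\<Prod>u\<in>S. [:-u, 1:]) * h"
  using assms(2-)
proof (induction S rule: finite_induct)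
  case empty
  show ?case by (rule exI[of _ g]) simp
next
  case (insert v S)
  let ?W = "\<Prod>u\<in>S. [:-u, 1:]"
  obtain h where h: "[:p:] dvd g - ?W * h"
    using insert.IH insert.prems by (auto simp: inj_on_insert)
  have "p dvd poly g v - poly ?W v * poly h v"
    using const_dvd_poly_value[OF h, of v] by simp
  moreover have "p dvd poly g v" using insert.prems by simp
  ultimately have "p dvd poly ?W v * poly h v"
    using dvd_diff_right_iff[of p "poly g v"] by blast
  moreover have "\<not> p dvd poly ?W v"
  proof
    assume "p dvd poly ?W v"
    then have "p dvd (\<Prod>u\<in>S. v - u)" by (simp add: poly_prod)
    then obtain u where "u \<in> S" "p dvd v - u"
      using assms(1) insert.hyps by (auto simp: prime_dvd_prod_iff)
    then have "v mod p = u mod p" by (simp add: mod_eq_dvd_iff)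
    then show False using \<open>u \<in> S\<close> insert.prems insert.hyps by (auto simp: inj_on_def)
  qed
  ultimately have hv: "p dvd poly h v" using assms(1) prime_dvd_mult_iff by blast
  have "?W * h = ?W * ([:-v, 1:] * synthetic_div h v + [:poly h v:])"
    using synthetic_div_correct'[of v h] by presburger
  also have "\<dots> = (\<Prod>u\<in>insert v S. [:-u, 1:]) * synthetic_div h v + ?W * [:poly h v:]"
    unfolding prod.insert[OF insert.hyps] by (simp only: distrib_left mult_ac)
  finally have "g - (\<Prod>u\<in>insert v S. [:-u, 1:]) * synthetic_div h v
      = (g - ?W * h) + ?W * [:poly h v:]"
    by (simp only: diff_conv_add_uminus minus_add_distrib add_ac)
  moreover have "[:p:] dvd [:poly h v:]" using hv by simp
  ultimately show ?case using h by (metis dvd_add dvd_mult)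
qed

text \<open>The weight \<open>X(X - 1)\<close> makes this derivation multiply \<open>X\<^sup>a(X - 1)\<^sup>b\<close> by a linear
  polynomial. Hence all iterates of \<open>X\<^sup>i X\<^sup>t\<^sup>j (X - 1)\<^sup>t\<^sup>k\<close>, evaluated at a point \<open>u\<close>, depend on the large
  powers only through the constants \<open>u\<^sup>t\<close> and \<open>(u - 1)\<^sup>t\<close>.\<close>

definition euler_deriv :: "int poly \<Rightarrow> int poly" where
  "euler_deriv f = [:0, -1, 1:] * pderiv f"

lemma euler_deriv_add: "euler_deriv (f + g) = euler_deriv f + euler_deriv g"
  by (simp add: euler_deriv_def pderiv_add distrib_left del: mult_pCons_left)

lemma euler_deriv_mult: "euler_deriv (f * g) = f * euler_deriv g + g * euler_deriv f"
  by (simp add: euler_deriv_def pderiv_mult algebra_simps del: mult_pCons_left)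

lemma funpow_euler_deriv_add:
  "(euler_deriv ^^ n) (f + g) = (euler_deriv ^^ n) f + (euler_deriv ^^ n) g"
  by (induction n) (auto simp: euler_deriv_add)

lemma funpow_euler_deriv_smult:
  "(euler_deriv ^^ n) (smult c f) = smult c ((euler_deriv ^^ n) f)"
  by (induction n) (auto simp: euler_deriv_def pderiv_smult simp del: mult_pCons_left)

lemma funpow_euler_deriv_sum:
  "(euler_deriv ^^ n) (sum f A) = (\<Sum>x\<in>A. (euler_deriv ^^ n) (f x))"
proof (induction A rule: infinite_finite_induct)
  case (insert x A)
  then show ?case by (simp add: funpow_euler_deriv_add)
qed (use funpow_euler_deriv_smult[of n 0 0] in auto)

text \<open>Modulo W, only those terms of the Leibniz rule survive in which the m derivations hit
  the m factors W once each, and there are m! of them.\<close>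

lemma funpow_euler_deriv_power_mult:
  "\<exists>h. (euler_deriv ^^ m) (W ^ m * g)
       = smult (fact m) (euler_deriv W ^ m * g) + W * h"
proof (induction m arbitrary: g)
  case 0
  show ?case by (rule exI[of _ 0]) simp
next
  case (Suc m)
  let ?g = "smult (of_nat (Suc m)) (euler_deriv W * g) + W * euler_deriv g"
  have pw: "euler_deriv (W ^ Suc m) = W ^ m * smult (of_nat (Suc m)) (euler_deriv W)"
    by (simp add: euler_deriv_def pderiv_power_Suc mult_ac del: power_Suc mult_pCons_left mult_pCons_right)
  have "euler_deriv (W ^ Suc m * g) = W ^ m * ?g"
    unfolding euler_deriv_mult pw by (simp add: algebra_simps)
  then have "(euler_deriv ^^ Suc m) (W ^ Suc m * g) = (euler_deriv ^^ m) (W ^ m * ?g)"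
    by (simp add: funpow_Suc_right del: funpow.simps)
  moreover obtain h where "(euler_deriv ^^ m) (W ^ m * ?g)
       = smult (fact m) (euler_deriv W ^ m * ?g) + W * h"
    using Suc.IH by blast
  moreover have "smult (fact m) (euler_deriv W ^ m * ?g) + W * h
      = smult (fact (Suc m)) (euler_deriv W ^ Suc m * g)
        + W * (smult (fact m) (euler_deriv W ^ m * euler_deriv g) + h)"
    by (simp add: algebra_simps smult_add_right smult_add_left)
  ultimately show ?case by metis
qed

text \<open>If f agrees with W^m h modulo p, the m-th iterate of f at a root u of W is m! times the
  m-th power of \<open>euler_deriv W\<close> at u times h(u). The first two factors are units modulo
  p, so h vanishes on \<open>S\<close> and another factor W splits off. The derivation has the
  weight u(u - 1), which is why 0 and 1 are kept out of \<open>S\<close>.\<close>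

lemma exists_cofactor_mod_multiple_roots:
  fixes p :: nat and f :: "int poly"
  assumes p: "prime p" and S: "S \<subseteq> {2..<int p}" and d: "d \<le> p"
    and vanish: "\<And>u n. u \<in> S \<Longrightarrow> n < d \<Longrightarrow> int p dvd poly ((euler_deriv ^^ n) f) u"
  shows "\<exists>h. [:int p:] dvd f - (\<Prod>u\<in>S. [:-u, 1:]) ^ d * h"
  using d vanish
proof (induction d)
  case 0
  show ?case by (rule exI[of _ f]) simp
next
  case (Suc m)
  let ?W = "\<Prod>u\<in>S. [:-u, 1:]"
  have fin: "finite S" using S finite_subset by blast
  have pr: "prime (int p)" using p by simp
  have inj: "inj_on (\<lambda>u. u mod int p) S"
  proof (rule inj_onI)
    fix x y assume xy: "x \<in> S" "y \<in> S" "x mod int p = y mod int p"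
    have "x mod int p = x" "y mod int p = y" using xy(1,2) S by (auto intro!: mod_pos_pos_trivial)
    then show "x = y" using xy(3) by metis
  qed
  obtain h where h: "[:int p:] dvd f - ?W ^ m * h"
    using Suc by auto
  then obtain k where k: "f - ?W ^ m * h = [:int p:] * k" by (auto elim: dvdE)
  then have fe: "f = ?W ^ m * h + smult (int p) k" by (simp add: algebra_simps)
  have "int p dvd poly h u" if u: "u \<in> S" for u
  proof -
    obtain h' where h': "(euler_deriv ^^ m) (?W ^ m * h)
       = smult (fact m) (euler_deriv ?W ^ m * h) + ?W * h'"
      using funpow_euler_deriv_power_mult by blast
    have Wu: "poly ?W u = 0"
      using u fin by (auto simp: poly_prod)
    have "int p dvd poly ((euler_deriv ^^ m) f) u"
      using Suc.prems u by simp
    then have "int p dvd fact m * (poly (euler_deriv ?W) u ^ m * poly h u)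
         + int p * poly ((euler_deriv ^^ m) k) u"
      unfolding fe funpow_euler_deriv_add h' funpow_euler_deriv_smult by (simp add: Wu)
    then have *: "int p dvd fact m * (poly (euler_deriv ?W) u ^ m * poly h u)"
      by (metis dvd_add_left_iff dvd_triv_left)
    \<comment> \<open>This is where \<open>d \<le> p\<close> enters: m is less than p, so m! is a
      unit modulo p.\<close>
    have "\<not> p dvd fact m"
      using p Suc.prems(1) by (simp add: prime_dvd_fact_iff)
    then have fm: "\<not> int p dvd fact m"
      by (metis int_dvd_int_iff of_nat_fact)
    have Weq: "?W = [:-u, 1:] * (\<Prod>v\<in>S - {u}. [:-v, 1:])"
      using u fin by (simp add: prod.remove)
    have "poly (euler_deriv ?W) u = u * (u - 1) * (\<Prod>v\<in>S - {u}. u - v)"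
      unfolding Weq euler_deriv_def pderiv_mult
      by (simp add: poly_prod pderiv_pCons algebra_simps)
    moreover have "\<not> int p dvd u * (u - 1) * (\<Prod>v\<in>S - {u}. u - v)"
    proof
      assume "int p dvd u * (u - 1) * (\<Prod>v\<in>S - {u}. u - v)"
      then consider "int p dvd u" | "int p dvd u - 1" | v where "v \<in> S - {u}" "int p dvd u - v"
        using pr fin by (auto simp: prime_dvd_mult_iff prime_dvd_prod_iff)
      then show False
      proof cases
        case 1 then show False using S u zdvd_imp_le[of "int p" u] by (auto simp: subset_iff)
      next
        case 2 then show False using S u zdvd_imp_le[of "int p" "u - 1"] by (auto simp: subset_iff)
      next
        case (3 v)
        then have "u mod int p = v mod int p" by (simp add: mod_eq_dvd_iff)
        then show False using 3 inj u by (auto simp: inj_on_def)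
      qed
    qed
    ultimately have "\<not> int p dvd poly (euler_deriv ?W) u ^ m"
      using pr prime_dvd_power by metis
    then show ?thesis using * fm pr by (auto simp: prime_dvd_mult_iff)
  qed
  then obtain h2 where h2: "[:int p:] dvd h - ?W * h2"
    using exists_cofactor_mod_roots[OF pr fin inj] by blast
  have "f - ?W ^ Suc m * h2 = (f - ?W ^ m * h) + ?W ^ m * (h - ?W * h2)"
    by (simp add: algebra_simps)
  then show ?case using h h2 by (metis dvd_add dvd_mult)
qed

text \<open>A degree count over the field with p elements: if h were nonzero there, the product of
  the monic M and h would have a leading term in a degree that f does not reach.\<close>

lemma monic_mult_dvd_const_imp:
  fixes p :: int and M h f :: "int poly"
  assumes "lead_coeff M = 1" "[:p:] dvd f - M * h" "degree f < degree M"
  shows "[:p:] dvd h"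
proof (rule ccontr)
  assume nd: "\<not> [:p:] dvd h"
  \<comment> \<open>Reducing the coefficients makes the leading coefficient of a nonzero h' nonzero
    modulo p, which that of h need not be.\<close>
  define h' where "h' = map_poly (\<lambda>c. c mod p) h"
  have hc: "coeff h' n = coeff h n mod p" for n
    by (simp add: h'_def coeff_map_poly)
  have dd: "[:p:] dvd h - h'"
    by (simp add: const_poly_dvd_iff hc)
  then have "h' \<noteq> 0" using nd by auto
  then have l: "coeff h' (degree h') \<noteq> 0" by simp
  then have "\<not> p dvd coeff h' (degree h')"
    unfolding hc by (metis dvd_eq_mod_eq_0 mod_mod_trivial)
  moreover have "[:p:] dvd f - M * h'"
  proof -
    have "f - M * h' = (f - M * h) + M * (h - h')" by (simp add: algebra_simps)
    then show ?thesis using assms(2) dd by (metis dvd_add dvd_mult)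
  qed
  then have "p dvd coeff (f - M * h') (degree M + degree h')"
    by (simp add: const_poly_dvd_iff)
  then have "p dvd coeff f (degree M + degree h') - lead_coeff M * coeff h' (degree h')"
    by (simp add: coeff_mult_degree_sum)
  then have "p dvd coeff h' (degree h')"
    using assms(1,3) by (simp add: coeff_eq_0)
  ultimately show False by simp
qed

text \<open>The d-th power of the product of the X - u is monic of degree d|S| and divides f modulo
  p. This closes Stepanov's argument: a polynomial of small degree that vanishes to high order on
  \<open>S\<close> bounds the size of \<open>S\<close>.\<close>

lemma multiple_roots_mod_degree:
  fixes p :: nat and f :: "int poly"
  assumes p: "prime p" and S: "S \<subseteq> {2..<int p}" and d: "d \<le> p"
    and vanish: "\<And>u n. u \<in> S \<Longrightarrow> n < d \<Longrightarrow> int p dvd poly ((euler_deriv ^^ n) f) u"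
    and nz: "\<not> [:int p:] dvd f"
  shows "d * card S \<le> degree f"
proof (rule ccontr)
  assume "\<not> d * card S \<le> degree f"
  let ?W = "\<Prod>u\<in>S. [:-u, 1:]"
  obtain h where h: "[:int p:] dvd f - ?W ^ d * h"
    using exists_cofactor_mod_multiple_roots[OF p S d vanish] by blast
  have lW: "lead_coeff ?W = 1" by (simp add: lead_coeff_prod)
  have "degree ?W = card S" by (simp add: degree_prod_eq_sum_degree)
  then have "degree (?W ^ d) = d * card S"
    by (subst degree_power_eq) (use lW in auto)
  moreover have "lead_coeff (?W ^ d) = 1" using lW by (simp only: lead_coeff_power) simp
  ultimately have "[:int p:] dvd h"
    using monic_mult_dvd_const_imp[OF _ h] \<open>\<not> d * card S \<le> degree f\<close> by simp
  then have "[:int p:] dvd (f - ?W ^ d * h) + ?W ^ d * h" using h by (meson dvd_add dvd_mult)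
  then show False using nz by simp
qed

text \<open>In characteristic zero, a polynomial with k monomials that vanishes to order k at 1 is
  zero. Modulo p this persists while the exponents stay below p, because differences of distinct
  exponents are then units.\<close>

lemma sparse_mod_not_divisible:
  fixes p :: nat and g h :: "int poly"
  assumes "prime p" "finite E" "E \<subseteq> {..<p}" "\<And>n. n \<notin> E \<Longrightarrow> int p dvd coeff g n"
    "[:int p:] dvd g - [:-1, 1:] ^ card E * h"
  shows "[:int p:] dvd g"
  using assms(2-)
proof (induction E arbitrary: g h rule: finite_induct)
  case empty
  then show ?case by (simp add: const_poly_dvd_iff)
next
  case (insert e E)
  \<comment> \<open>\<open>T\<close> kills the monomial \<open>X\<^sup>e\<close> and lowers the order of vanishing at 1 by at most one.\<close>
  define T where "T f = [:0, 1:] * pderiv f - smult (int e) f" for f :: "int poly"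
  have Tc: "coeff (T f) n = (int n - int e) * coeff f n" for f n
    by (cases n) (auto simp: T_def coeff_pderiv algebra_simps)
  have pr: "prime (int p)" using assms(1) by simp
  have card: "card (insert e E) = Suc (card E)" using insert by simp
  have T1: "[:int p:] dvd T g - [:-1, 1:] ^ card E
         * (smult (int (Suc (card E))) ([:0, 1:] * h) + [:-1, 1:] * T h)"
  proof -
    have "T (g - [:-1, 1:] ^ card (insert e E) * h)
        = T g - [:-1, 1:] ^ card E * (smult (int (Suc (card E))) ([:0, 1:] * h) + [:-1, 1:] * T h)"
      unfolding T_def card pderiv_diff pderiv_mult pderiv_power_Suc
      by (simp add: algebra_simps pderiv_pCons smult_diff_right smult_add_right)
    moreover have "[:int p:] dvd T (g - [:-1, 1:] ^ card (insert e E) * h)"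
      using insert.prems(3) by (auto simp: const_poly_dvd_iff Tc)
    ultimately show ?thesis by simp
  qed
  have "[:int p:] dvd T g"
  proof (rule insert.IH[OF _ _ T1])
    show "E \<subseteq> {..<p}" using insert.prems by simp
    show "int p dvd coeff (T g) n" if "n \<notin> E" for n
      using that insert.prems(2)[of n] by (cases "n = e") (auto simp: Tc)
  qed
  then have Tg: "int p dvd (int n - int e) * coeff g n" for n
    by (simp add: const_poly_dvd_iff Tc)
  have gn: "int p dvd coeff g n" if "n \<noteq> e" for n
  proof (cases "n \<in> E")
    case True
    then have "n < p" "e < p" using insert.prems by auto
    have "\<not> int p dvd int n - int e"
    proof
      assume "int p dvd int n - int e"
      then have "int n mod int p = int e mod int p" by (simp add: mod_eq_dvd_iff)
      then show False using \<open>n < p\<close> \<open>e < p\<close> that by simp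
    qed
    then show ?thesis using Tg[of n] pr by (simp add: prime_dvd_mult_iff)
  next
    case False
    then show ?thesis using insert.prems that by simp
  qed
  \<comment> \<open>Only X^e is left. Its coefficient is its value at 1, and g still vanishes at
    1.\<close>
  have "[:int p:] dvd g - monom (coeff g e) e"
    using gn by (auto simp: const_poly_dvd_iff)
  then have "int p dvd poly g 1 - coeff g e"
    using const_dvd_poly_value[of "int p" "g - monom (coeff g e) e" 1] by (simp add: poly_monom)
  moreover have "int p dvd poly g 1"
    using const_dvd_poly_value[OF insert.prems(3), of 1] card by simp
  ultimately have "int p dvd coeff g e"
    by (metis dvd_diff_right_iff)
  then show ?case using gn by (metis const_poly_dvd_iff)
qed

text \<open>Modulo (X - 1)^t only g 0 remains. It has at most t monomials, hence vanishes modulo p;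
  then one factor (X - 1)^t can be cancelled, since p is a prime element of the polynomial ring, and
  the next summand takes its place.\<close>

lemma sparse_combination_mod_nonzero:
  fixes p t :: nat and g :: "nat \<Rightarrow> int poly"
  assumes p: "prime p" and E: "E \<subseteq> {..<p}" "card E \<le> t"
    and sp: "\<And>k n. n \<notin> E \<Longrightarrow> coeff (g k) n = 0"
    and dv: "[:int p:] dvd (\<Sum>k<b. [:-1, 1:] ^ (t * k) * g k)"
  shows "\<forall>k<b. [:int p:] dvd g k"
  using sp dv
proof (induction b arbitrary: g)
  case (Suc b)
  let ?Y = "[:-1, 1:] ^ t :: int poly"
  let ?R = "\<Sum>k<b. [:-1, 1:] ^ (t * k) * g (Suc k)"
  have pe: "prime_elem [:int p:]" using p by (simp add: prime_elem_const_poly_iff)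
  have eq: "(\<Sum>k<Suc b. [:-1, 1:] ^ (t * k) * g k) = g 0 + ?Y * ?R"
    unfolding sum.lessThan_Suc_shift
    by (simp add: sum_distrib_left power_add mult.assoc)
  have "?Y = [:-1, 1:] ^ card E * [:-1, 1:] ^ (t - card E)"
    using E by (simp flip: power_add)
  then have "[:int p:] dvd g 0 - [:-1, 1:] ^ card E * (- ([:-1, 1:] ^ (t - card E) * ?R))"
    using Suc.prems(2) unfolding eq by (simp add: mult.assoc)
  then have g0: "[:int p:] dvd g 0"
    by (rule sparse_mod_not_divisible[OF p finite_subset[OF E(1)] E(1), rotated 2])
      (simp_all add: Suc.prems(1))
  have "[:int p:] dvd ?Y * ?R"
    using Suc.prems(2) unfolding eq dvd_add_right_iff[OF g0] .
  moreover have "\<not> [:int p:] dvd ?Y"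
  proof
    assume "[:int p:] dvd ?Y"
    then have "[:int p:] dvd [:-1, 1:]" using pe prime_elem_dvd_power by blast
    then show False using p by (auto simp: const_poly_dvd_iff dest!: spec[of _ 1])
  qed
  ultimately have "[:int p:] dvd ?R" using pe by (simp add: prime_elem_dvd_mult_iff)
  then have "\<forall>k<b. [:int p:] dvd g (Suc k)" by (intro Suc.IH) (use Suc.prems in auto)
  then show ?case using g0 by (metis less_Suc_eq_0_disj)
qed simp

text \<open>Pigeonhole in place of linear algebra: there are more vectors of residues than possible
  values of the linear forms, so two vectors have the same values, and their difference is a
  solution.\<close>

lemma exists_nontrivial_solution_mod:
  fixes p :: nat and M :: "'j \<Rightarrow> 'i \<Rightarrow> int"
  assumes "p \<ge> 2" "finite I" "finite J" "card J < card I"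
  shows "\<exists>l. (\<exists>i\<in>I. \<not> int p dvd l i) \<and> (\<forall>j\<in>J. int p dvd (\<Sum>i\<in>I. l i * M j i))"
proof -
  define F where "F x = (\<lambda>j\<in>J. (\<Sum>i\<in>I. x i * M j i) mod int p)" for x
  let ?A = "I \<rightarrow>\<^sub>E {0..<int p}" and ?B = "J \<rightarrow>\<^sub>E {0..<int p}"
  have "F ` ?A \<subseteq> ?B" using assms(1) by (auto simp: F_def)
  moreover have "finite ?B" using assms by (simp add: finite_PiE)
  moreover have "card ?B < card ?A"
    using assms by (simp add: card_PiE power_strict_increasing)
  ultimately have "\<not> inj_on F ?A"
    by (metis card_inj_on_le leD)
  then obtain x y where xy: "x \<in> ?A" "y \<in> ?A" "F x = F y" "x \<noteq> y" by (auto simp: inj_on_def)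
  then obtain i where i: "i \<in> I" "x i \<noteq> y i" by (meson PiE_ext)
  have "\<not> int p dvd x i - y i"
  proof
    assume "int p dvd x i - y i"
    then have "x i mod int p = y i mod int p" by (simp add: mod_eq_dvd_iff)
    moreover have "x i \<in> {0..<int p}" "y i \<in> {0..<int p}" using xy i by auto
    ultimately show False using i by simp
  qed
  moreover have "int p dvd (\<Sum>i\<in>I. (x i - y i) * M j i)" if "j \<in> J" for j
  proof -
    have "(\<Sum>i\<in>I. x i * M j i) mod int p = (\<Sum>i\<in>I. y i * M j i) mod int p"
      using fun_cong[OF xy(3), of j] that by (simp add: F_def)
    then show ?thesis by (simp add: mod_eq_dvd_iff left_diff_distrib sum_subtractf)
  qed
  ultimately show ?thesis using i by (intro exI[of _ "\<lambda>i. x i - y i"]) auto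
qed

section \<open>Stepanov's method\<close>

lemma euler_deriv_two_powers:
  "euler_deriv ([:0, 1:] ^ a * [:-1, 1:] ^ b)
     = [:0, 1:] ^ a * [:-1, 1:] ^ b * [:- int a, int (a + b):]"
proof -
  let ?X = "[:0, 1:] :: int poly" and ?Y = "[:-1, 1:] :: int poly"
  have X: "?X * pderiv (?X ^ a) = ?X ^ a * [:int a:]"
    by (cases a) (simp_all add: pderiv_power_Suc pderiv_pCons mult_ac del: power_Suc, simp)
  have Y: "?Y * pderiv (?Y ^ b) = ?Y ^ b * [:int b:]"
    by (cases b) (simp_all add: pderiv_power_Suc pderiv_pCons mult_ac del: power_Suc, simp)
  have w: "[:0, -1, 1:] = ?X * ?Y" by simp
  have "euler_deriv (?X ^ a * ?Y ^ b)
      = ?X ^ a * ?X * (?Y * pderiv (?Y ^ b)) + ?Y ^ b * ?Y * (?X * pderiv (?X ^ a))"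
    unfolding euler_deriv_def pderiv_mult w by (simp only: algebra_simps)
  also have "\<dots> = ?X ^ a * ?Y ^ b * (?X * [:int b:] + ?Y * [:int a:])"
    unfolding X Y by (simp only: algebra_simps)
  also have "?X * [:int b:] + ?Y * [:int a:] = [:- int a, int (a + b):]" by simp
  finally show ?thesis .
qed

text \<open>The conjugate of \<open>euler_deriv\<close> by multiplication with X^a (X - 1)^b: the
  large powers stay outside and only a polynomial of small degree is transformed.\<close>

definition twisted_deriv :: "nat \<Rightarrow> nat \<Rightarrow> int poly \<Rightarrow> int poly" where
  "twisted_deriv a b r = [:- int a, int (a + b):] * r + euler_deriv r"

lemma funpow_euler_deriv_two_powers:
  "(euler_deriv ^^ n) ([:0, 1:] ^ a * [:-1, 1:] ^ b * r)
     = [:0, 1:] ^ a * [:-1, 1:] ^ b * (twisted_deriv a b ^^ n) r"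
proof (induction n)
  case (Suc n)
  let ?F = "[:0, 1:] ^ a * [:-1, 1:] ^ b :: int poly"
  have "euler_deriv (?F * r) = ?F * twisted_deriv a b r" for r
    unfolding euler_deriv_mult[of ?F r] twisted_deriv_def euler_deriv_two_powers
    by (simp only: algebra_simps)
  then show ?case using Suc by simp
qed simp

text \<open>Growth by at most one per step keeps the number of coefficients that must vanish, and so
  the number of linear conditions, independent of t.\<close>

lemma degree_funpow_twisted_deriv:
  "degree ((twisted_deriv a b ^^ n) r) \<le> degree r + n"
proof (induction n)
  case (Suc n)
  have step: "degree (twisted_deriv a b r) \<le> Suc (degree r)" for r
  proof -
    have "degree ([:- int a, int (a + b):] * r) \<le> Suc (degree r)"
      using degree_mult_le[of "[:- int a, int (a + b):]" r] by (simp split: if_splits)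
    moreover have "degree (euler_deriv r) \<le> Suc (degree r)"
    proof (cases "degree r = 0")
      case True
      then have "pderiv r = 0" by (simp add: pderiv_eq_0_iff)
      then show ?thesis by (simp add: euler_deriv_def)
    next
      case False
      have "degree (euler_deriv r) \<le> 2 + degree (pderiv r)"
        unfolding euler_deriv_def using degree_mult_le[of "[:0, -1, 1::int:]" "pderiv r"]
        by simp
      then show ?thesis using False by (simp add: degree_pderiv)
    qed
    ultimately show ?thesis unfolding twisted_deriv_def by (rule degree_add_le)
  qed
  show ?case using Suc step[of "(twisted_deriv a b ^^ n) r"] by simp
qed simp

text \<open>Collecting the terms by the power of (X - 1)^t leaves polynomials in X with at most AB
  \<le> t exponents, all below Bt \<le> p, which is exactly the situation of
  \<open>sparse_combination_mod_nonzero\<close>.\<close>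

lemma stepanov_polynomial_nonzero:
  fixes p t A B :: nat and l :: "nat \<times> nat \<times> nat \<Rightarrow> int"
  assumes p: "prime p" and AB: "A * B \<le> t" and Bt: "B * t \<le> p"
    and dv: "[:int p:] dvd (\<Sum>(i, j, k)\<in>{..<A} \<times> {..<B} \<times> {..<B}.
        smult (l (i, j, k)) ([:0, 1:] ^ (t * j) * [:-1, 1:] ^ (t * k) * [:0, 1:] ^ i))"
    and ijk: "i < A" "j < B" "k < B"
  shows "int p dvd l (i, j, k)"
proof -
  let ?X = "[:0, 1:] :: int poly" and ?Y = "[:-1, 1:] :: int poly"
  define g where "g k = (\<Sum>(i, j)\<in>{..<A} \<times> {..<B}. monom (l (i, j, k)) (i + t * j))" for k
  define E where "E = (\<lambda>(i, j). i + t * j) ` ({..<A} \<times> {..<B})"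
  have "0 < B" using ijk by simp
  then have At: "A \<le> t" using AB by (metis Suc_leI le_trans mult.right_neutral mult_le_mono2 One_nat_def)
  have bound: "i + t * j < t * B" if "i < A" "j < B" for i j
  proof -
    have "i + t * j < t * Suc j" using that At by simp
    also have "\<dots> \<le> t * B" using that by (intro mult_le_mono2) simp
    finally show ?thesis .
  qed
  have "E \<subseteq> {..<p}"
    using bound Bt unfolding E_def by (fastforce simp: mult.commute)
  have "card E \<le> A * B"
    unfolding E_def using card_image_le[of "{..<A} \<times> {..<B}" "\<lambda>(i, j). i + t * j"] by simp
  have sp: "coeff (g k) n = 0" if "n \<notin> E" for k n
    using that unfolding g_def E_def coeff_sum
    by (intro sum.neutral) (auto simp: image_iff)
  have mon: "smult c (?X ^ (t * j) * ?Y ^ (t * k) * ?X ^ i) = ?Y ^ (t * k) * monom c (i + t * j)"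
    for c i j k
    by (simp add: monom_altdef power_add mult_ac del: mult_pCons_left mult_pCons_right)
  have "(\<Sum>(i, j, k)\<in>{..<A} \<times> {..<B} \<times> {..<B}.
        smult (l (i, j, k)) (?X ^ (t * j) * ?Y ^ (t * k) * ?X ^ i))
      = (\<Sum>k<B. ?Y ^ (t * k) * g k)"
    unfolding mon g_def sum_distrib_left sum.cartesian_product[symmetric] split_beta fst_conv snd_conv
    by (rule trans[OF sum.cong[OF refl sum.swap] sum.swap])
  then have "[:int p:] dvd (\<Sum>k<B. ?Y ^ (t * k) * g k)" using dv by simp
  then have "[:int p:] dvd g k"
    using sparse_combination_mod_nonzero[where g = g, OF p \<open>E \<subseteq> {..<p}\<close> _ sp] \<open>card E \<le> A * B\<close> AB ijk
    by (meson le_trans)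
  then have "int p dvd coeff (g k) (i + t * j)" by (simp add: const_poly_dvd_iff)
  also have "coeff (g k) (i + t * j) = (\<Sum>x\<in>{..<A} \<times> {..<B}. if x = (i, j) then l (i, j, k) else 0)"
    unfolding g_def coeff_sum
  proof (rule sum.cong[OF refl])
    fix x assume "x \<in> {..<A} \<times> {..<B}"
    then obtain i' j' where x: "x = (i', j')" "i' < A" "j' < B" by auto
    \<comment> \<open>Since i < A \<le> t, the numbers i and j are remainder and quotient of the
      exponent modulo t, so different pairs belong to different monomials.\<close>
    have "(i' + t * j') mod t = i'" "(i + t * j) mod t = i" "(i' + t * j') div t = j'" "(i + t * j) div t = j"
      using x(2,3) ijk(1,2) At by auto
    then have "i' + t * j' = i + t * j \<longleftrightarrow> i' = i \<and> j' = j" by metis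
    then show "coeff (case x of (i, j) \<Rightarrow> monom (l (i, j, k)) (i + t * j)) (i + t * j)
        = (if x = (i, j) then l (i, j, k) else 0)"
      using x by auto
  qed
  also have "\<dots> = l (i, j, k)" using ijk by simp
  finally show ?thesis .
qed

text \<open>The unknowns are the A B^2 coefficients l. Vanishing to order A at all points of
  \<open>S\<close> costs few conditions because the large powers at a point u depend only on the
  pair of u^t and (u - 1)^t, which lies in \<open>P\<close>. Comparing the order A on
  \<open>S\<close> with the degree, at most 2tB, gives the bound.\<close>

lemma stepanov_bound:
  fixes p t A B :: nat and P :: "(int \<times> int) set"
  assumes p: "prime p" and P: "finite P" and S: "S \<subseteq> {2..<int p}"
    and SP: "\<And>u. u \<in> S \<Longrightarrow> (u ^ t mod int p, (u - 1) ^ t mod int p) \<in> P"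
    and AB: "A * B \<le> t" and Bt: "B * t \<le> p" and Ap: "A \<le> p"
    and count: "card P * A * (2 * A) < A * B * B"
  shows "A * card S \<le> 2 * t * B"
proof -
  let ?X = "[:0, 1:] :: int poly" and ?Y = "[:-1, 1:] :: int poly"
  let ?I = "{..<A} \<times> {..<B} \<times> {..<B}"
  \<comment> \<open>One condition for each pair in \<open>P\<close>, each order n < A and each
    coefficient; the degrees i + n stay below 2A.\<close>
  let ?J = "P \<times> {..<A} \<times> {..<2 * A}"
  define r where "r n = (\<lambda>(i, j, k). (twisted_deriv (t * j) (t * k) ^^ n) (?X ^ i))" for n
  define M where "M = (\<lambda>((c, d), n, m) (i, j, k). c ^ j * d ^ k * coeff (r n (i, j, k)) m)"
  have "card ?J < card ?I" using count by (simp add: card_cartesian_product mult_ac)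
  then obtain l where l: "\<exists>x\<in>?I. \<not> int p dvd l x" "\<forall>y\<in>?J. int p dvd (\<Sum>x\<in>?I. l x * M y x)"
    using exists_nontrivial_solution_mod[of p ?I ?J M] P p prime_ge_2_nat by auto
  define f where "f = (\<Sum>(i, j, k)\<in>?I. smult (l (i, j, k)) (?X ^ (t * j) * ?Y ^ (t * k) * ?X ^ i))"
  have nz: "\<not> [:int p:] dvd f"
    using stepanov_polynomial_nonzero[OF p AB Bt, of l] l(1) unfolding f_def by blast
  have Xi: "degree (?X ^ i) = i" for i by (simp add: degree_power_eq)
  have Yi: "degree (?Y ^ i) = i" for i by (simp add: degree_power_eq)
  have df: "degree f \<le> 2 * t * B"
    unfolding f_def
  proof (rule degree_sum_le, simp, clarify)
    fix i j k assume ijk: "i < A" "j < B" "k < B"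
    have "degree (smult (l (i, j, k)) (?X ^ (t * j) * ?Y ^ (t * k) * ?X ^ i))
        \<le> degree (?X ^ (t * j) * ?Y ^ (t * k) * ?X ^ i)" by (rule degree_smult_le)
    also have "\<dots> \<le> t * j + t * k + i"
      by (metis (mono_tags, lifting) degree_mult_le Xi Yi add_le_mono1 le_trans)
    also have "\<dots> \<le> t * j + t * k + t"
    proof -
      have "A \<le> t" using AB ijk
        by (metis Suc_leI le_trans mult.right_neutral mult_le_mono2 One_nat_def gr_implies_not0 neq0_conv)
      then show ?thesis using ijk by simp
    qed
    also have "\<dots> \<le> t * (B - 1) + t * (B - 1) + t"
      using ijk by (intro add_mono mult_le_mono2) auto
    also have "\<dots> \<le> 2 * t * B" using ijk by (cases B) auto
    finally show "degree (smult (l (i, j, k)) (?X ^ (t * j) * ?Y ^ (t * k) * ?X ^ i)) \<le> 2 * t * B" .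
  qed
  have "int p dvd poly ((euler_deriv ^^ n) f) u" if u: "u \<in> S" and n: "n < A" for u n
  proof -
    define c where "c = u ^ t mod int p"
    define d where "d = (u - 1) ^ t mod int p"
    have cd: "(c, d) \<in> P" using SP[OF u] by (simp add: c_def d_def)
    \<comment> \<open>This is the n-th iterate with the powers u^t and (u - 1)^t frozen to the
      constants c and d. The linear conditions say that it is the zero polynomial modulo p, so in
      particular it vanishes at u.\<close>
    define h where "h = (\<Sum>(i, j, k)\<in>?I. smult (l (i, j, k) * (c ^ j * d ^ k)) (r n (i, j, k)))"
    have "[:int p:] dvd h"
      unfolding const_poly_dvd_iff
    proof
      fix m
      show "int p dvd coeff h m"
      proof (cases "m < 2 * A")
        case True
        then have "int p dvd (\<Sum>x\<in>?I. l x * M ((c, d), n, m) x)" using l(2) cd n by blast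
        also have "(\<Sum>x\<in>?I. l x * M ((c, d), n, m) x) = coeff h m"
          unfolding h_def coeff_sum M_def by (rule sum.cong) (auto simp: mult_ac)
        finally show ?thesis .
      next
        case False
        have "coeff h m = 0"
          unfolding h_def coeff_sum
        proof (rule sum.neutral, clarify)
          fix i j k assume "i < A"
          have "degree (r n (i, j, k)) \<le> i + n"
            using degree_funpow_twisted_deriv[where a = "t * j" and b = "t * k" and n = n and r = "?X ^ i"] by (simp add: r_def Xi)
          then show "coeff (smult (l (i, j, k) * (c ^ j * d ^ k)) (r n (i, j, k))) m = 0"
            using False n \<open>i < A\<close> by (simp add: coeff_eq_0)
        qed
        then show ?thesis by simp
      qed
    qed
    then have hu: "int p dvd poly h u" by (rule const_dvd_poly_value)
    have e1: "poly ((euler_deriv ^^ n) f) u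
      = (\<Sum>(i, j, k)\<in>?I. l (i, j, k) * ((u ^ t) ^ j * ((u - 1) ^ t) ^ k) * poly (r n (i, j, k)) u)"
      unfolding f_def funpow_euler_deriv_sum split_beta funpow_euler_deriv_smult
        funpow_euler_deriv_two_powers poly_sum r_def
      by (rule sum.cong[OF refl]) (simp add: poly_power power_mult)
    have e2: "poly h u = (\<Sum>(i, j, k)\<in>?I. l (i, j, k) * (c ^ j * d ^ k) * poly (r n (i, j, k)) u)"
      unfolding h_def poly_sum by (rule sum.cong) auto
    have "[poly ((euler_deriv ^^ n) f) u = poly h u] (mod int p)"
      unfolding e1 e2 split_beta c_def d_def
      by (intro cong_sum cong_mult cong_refl cong_pow) (simp_all add: cong_def)
    then show ?thesis using hu by (simp add: cong_dvd_iff)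
  qed
  then have "A * card S \<le> degree f"
    using multiple_roots_mod_degree[OF p S Ap _ nz] by blast
  then show ?thesis using df by simp
qed

text \<open>\<open>N\<close> bounds the number of curves u^t = c, (u - 1)^t = d that are needed to
  cover \<open>S\<close>. With A of order (t^2 / N)^(1/3) and B of order t / A the unknowns
  outnumber the conditions, and the bound is |S| \<le> 2 (t / A)^2. The hypothesis 8N < t^2 says
  that A can be at least 1, and the one on p^3 gives Bt \<le> p.\<close>

lemma stepanov_curves:
  fixes p t N :: nat and P :: "(int \<times> int) set"
  assumes p: "prime p" and P: "finite P" "card P \<le> N" and S: "S \<subseteq> {2..<int p}"
    and SP: "\<And>u. u \<in> S \<Longrightarrow> (u ^ t mod int p, (u - 1) ^ t mod int p) \<in> P"
    and N: "N \<ge> 1" "8 * N < t\<^sup>2" "64 * N * t ^ 4 \<le> p ^ 3" and tp: "t \<le> p"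
  shows "card S ^ 3 \<le> 32768 * t\<^sup>2 * N\<^sup>2"
proof -
  have ex: "8 * N * 1 ^ 3 < t\<^sup>2" using N by simp
  have bd: "A \<le> t\<^sup>2" if "8 * N * A ^ 3 < t\<^sup>2" for A
  proof -
    have "A \<le> A ^ 3" by (cases "A = 0") (auto simp: self_le_power)
    also have "\<dots> \<le> 8 * N * A ^ 3" using N by simp
    finally show ?thesis using that by simp
  qed
  define A where "A = (GREATEST A. 8 * N * A ^ 3 < t\<^sup>2)"
  have A1: "8 * N * A ^ 3 < t\<^sup>2" "1 \<le> A"
    unfolding A_def using GreatestI_nat[where P = "\<lambda>A. 8 * N * A ^ 3 < t\<^sup>2", OF ex bd]
      Greatest_le_nat[where P = "\<lambda>A. 8 * N * A ^ 3 < t\<^sup>2", OF ex bd] by auto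
  have "\<not> 8 * N * (Suc A) ^ 3 < t\<^sup>2"
    unfolding A_def using Greatest_le_nat[where P = "\<lambda>A. 8 * N * A ^ 3 < t\<^sup>2", OF _ bd]
    by (metis not_less_eq_eq order_refl)
  then have "t\<^sup>2 \<le> 8 * N * (Suc A) ^ 3" by simp
  \<comment> \<open>Replacing A + 1 by 2A turns the factor 8 into 64, the constant in the hypothesis
    on p^3.\<close>
  also have "\<dots> \<le> 8 * N * (2 * A) ^ 3" using A1 by (intro mult_le_mono2 power_mono) auto
  finally have A2: "t\<^sup>2 \<le> 64 * N * A ^ 3" by (simp add: power_mult_distrib)
  have "t > 0" using N by (cases "t = 0") auto
  have At: "A \<le> t"
  proof (rule ccontr)
    assume "\<not> A \<le> t"
    then have "t ^ 2 \<le> A ^ 2" by (intro power_mono) auto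
    also have "\<dots> \<le> A ^ 3" using A1 by (intro power_increasing) auto
    also have "\<dots> \<le> 8 * N * A ^ 3" using N by simp
    finally show False using A1 by simp
  qed
  define B where "B = t div A"
  have AB: "A * B \<le> t" by (simp add: B_def)
  have B1: "1 \<le> B" using At A1 by (simp add: B_def Suc_leI div_greater_zero_iff)
  have "t < A * Suc B" unfolding B_def using A1
    by (metis dividend_less_times_div mult_Suc_right zero_less_one less_le_trans)
  also have "\<dots> \<le> A * (2 * B)" using B1 by (intro mult_le_mono2) auto
  finally have tAB: "t < 2 * A * B" by simp
  have Bt: "B * t \<le> p"
  proof -
    have "(t * t) ^ 3 * N \<le> (A * p) ^ 3 * N"
    proof -
      have "(t * t) ^ 3 * N = t ^ 2 * (N * t ^ 4)" by (simp add: power_mult_distrib eval_nat_numeral)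
      also have "\<dots> \<le> (64 * N * A ^ 3) * (N * t ^ 4)" using A2 by (rule mult_le_mono1)
      also have "\<dots> = A ^ 3 * N * (64 * N * t ^ 4)" by simp
      also have "\<dots> \<le> A ^ 3 * N * p ^ 3" using N by (intro mult_le_mono2) auto
      finally show ?thesis by (simp add: power_mult_distrib mult_ac)
    qed
    then have "(t * t) ^ 3 \<le> (A * p) ^ 3" using N by simp
    then have "t * t \<le> A * p" by (simp add: power_mono_iff)
    moreover have "A * (B * t) \<le> t * t" using mult_le_mono1[OF AB, of t] by (simp add: mult.assoc)
    ultimately have "A * (B * t) \<le> A * p" by linarith
    then show ?thesis using A1 by simp
  qed
  have cnt: "card P * A * (2 * A) < A * B * B"
  proof -
    have "4 * A * (N * A * (2 * A)) = 8 * N * A ^ 3" by (simp add: power3_eq_cube)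
    also have "\<dots> < t\<^sup>2" by fact
    also have "\<dots> \<le> (2 * A * B)\<^sup>2" using tAB by (intro power_mono) auto
    also have "\<dots> = 4 * A * (A * B * B)" by (simp add: power2_eq_square)
    finally have "N * A * (2 * A) < A * B * B" by (simp add: mult_ac)
    moreover have "card P * A * (2 * A) \<le> N * A * (2 * A)" using P by (intro mult_le_mono1)
    ultimately show ?thesis by linarith
  qed
  have "A * card S \<le> 2 * t * B"
    by (rule stepanov_bound[OF p P(1) S SP AB Bt _ cnt]) (use At tp in auto)
  then have "A * (A * card S) \<le> A * (2 * t * B)" by simp
  also have "\<dots> = 2 * t * (A * B)" by simp
  also have "\<dots> \<le> 2 * t * t" using AB by (intro mult_le_mono2)
  finally have "(A * A * card S) ^ 3 \<le> (2 * t * t) ^ 3" by (intro power_mono) auto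
  then have "A ^ 6 * card S ^ 3 \<le> 8 * t ^ 6" by (simp add: power_mult_distrib mult.assoc flip: power_add)
  moreover have "t ^ 4 * card S ^ 3 \<le> 4096 * N\<^sup>2 * (A ^ 6 * card S ^ 3)"
  proof -
    have "(t\<^sup>2)\<^sup>2 \<le> (64 * N * A ^ 3)\<^sup>2" using A2 by (intro power_mono) auto
    then have "t ^ 4 \<le> 4096 * N\<^sup>2 * A ^ 6" by (simp add: power_mult_distrib flip: power_mult)
    then have "t ^ 4 * card S ^ 3 \<le> 4096 * N\<^sup>2 * A ^ 6 * card S ^ 3" by (rule mult_le_mono1)
    then show ?thesis by (simp add: mult.assoc)
  qed
  ultimately have "t ^ 4 * card S ^ 3 \<le> 4096 * N\<^sup>2 * (8 * t ^ 6)"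
    using mult_le_mono2 le_trans by blast
  also have "\<dots> = t ^ 4 * (32768 * t\<^sup>2 * N\<^sup>2)" by (simp flip: power_add)
  finally show ?thesis using \<open>t > 0\<close> by simp
qed

section \<open>Elementary inequalities\<close>

text \<open>The value of rank r is at most A / r, so the sum is at most A times a harmonic sum.
  Removing the smallest value, whose rank is the size of \<open>S\<close>, makes this an induction,
  with 1/(n + 1) \<le> ln (n + 1) - ln n. All passages from level sets to moments rest on this; each
  costs one logarithm.\<close>

lemma sum_le_by_rank:
  fixes g :: "'a \<Rightarrow> real"
  assumes "finite S" "S \<noteq> {}" "\<And>x. x \<in> S \<Longrightarrow> g x \<ge> 0"
    "\<And>x. x \<in> S \<Longrightarrow> g x * real (card {y \<in> S. g x \<le> g y}) \<le> A"
  shows "sum g S \<le> A * (1 + ln (real (card S)))"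
  using assms
proof (induction "card S" arbitrary: S)
  case (Suc n)
  obtain x where x: "x \<in> S" "\<And>y. y \<in> S \<Longrightarrow> g x \<le> g y"
    using Suc.prems(1,2) by (metis arg_min_if_finite(1) arg_min_least)
  then have "{y \<in> S. g x \<le> g y} = S" by auto
  then have gx: "g x * real (Suc n) \<le> A" using Suc.prems(4)[OF x(1)] Suc.hyps(2) by simp
  have A: "A \<ge> 0" using gx Suc.prems(3)[OF x(1)] by (meson mult_nonneg_nonneg of_nat_0_le_iff order_trans)
  show ?case
  proof (cases "n = 0")
    case True
    then have "S = {x}" using Suc.hyps(2) x(1) by (metis One_nat_def card_1_singletonE singletonD)
    then show ?thesis using gx True by simp
  next
    case False
    let ?S = "S - {x}"
    have cS: "card ?S = n" using Suc.hyps(2) Suc.prems(1) x by simp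
    have "sum g ?S \<le> A * (1 + ln (real (card ?S)))"
    proof (rule Suc.hyps(1))
      show "n = card ?S" using cS by simp
      show "finite ?S" using Suc.prems(1) by simp
      show "?S \<noteq> {}" using cS False by (metis card.empty)
      show "g y \<ge> 0" if "y \<in> ?S" for y using that Suc.prems(3) by simp
      fix y assume y: "y \<in> ?S"
      have "card {z \<in> ?S. g y \<le> g z} \<le> card {z \<in> S. g y \<le> g z}"
        using Suc.prems(1) by (intro card_mono) auto
      then have "g y * real (card {z \<in> ?S. g y \<le> g z}) \<le> g y * real (card {z \<in> S. g y \<le> g z})"
        using y Suc.prems(3) by (intro mult_left_mono) auto
      then show "g y * real (card {z \<in> ?S. g y \<le> g z}) \<le> A"
        using Suc.prems(4)[of y] y by simp
    qed
    then have IH: "sum g ?S \<le> A * (1 + ln (real n))" using cS by simp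
    have "ln (real n / real (Suc n)) \<le> real n / real (Suc n) - 1"
      using False by (intro ln_le_minus_one) auto
    also have "\<dots> = - 1 / real (Suc n)" by (simp add: field_simps)
    finally have l: "1 / real (Suc n) \<le> ln (real (Suc n)) - ln (real n)"
      using False by (simp add: ln_div)
    have "g x \<le> A * (1 / real (Suc n))" using gx by (simp add: field_simps)
    also have "\<dots> \<le> A * (ln (real (Suc n)) - ln (real n))" using A l by (intro mult_left_mono)
    finally have "g x + sum g ?S \<le> A * (1 + ln (real (Suc n)))"
      using IH by (simp add: algebra_simps)
    then show ?thesis using Suc.hyps(2) Suc.prems(1) x(1) by (simp add: sum.remove)
  qed
qed simp

lemma sum_cubed_le:
  fixes a :: "'a \<Rightarrow> real"
  assumes "\<And>x. x \<in> S \<Longrightarrow> a x \<ge> 0"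
  shows "(\<Sum>x\<in>S. a x) ^ 3 \<le> real (card S) ^ 2 * (\<Sum>x\<in>S. a x ^ 3)"
proof (cases "card S = 0")
  case True
  then show ?thesis by (cases "finite S") auto
next
  case False
  let ?n = "real (card S)"
  define m where "m = (\<Sum>x\<in>S. a x) / ?n"
  have m0: "m \<ge> 0" unfolding m_def using assms by (simp add: sum_nonneg)
  have s: "(\<Sum>x\<in>S. a x) = ?n * m" using False by (simp add: m_def)
  \<comment> \<open>Tangent line of the cube at the mean.\<close>
  have "3 * m ^ 2 * b - 2 * m ^ 3 \<le> b ^ 3" if "b \<ge> 0" for b
  proof -
    have "b ^ 3 - (3 * m ^ 2 * b - 2 * m ^ 3) = (b - m) ^ 2 * (b + 2 * m)"
      by (simp add: power2_eq_square power3_eq_cube algebra_simps)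
    then show ?thesis using that m0 by (metis add_nonneg_nonneg diff_ge_0_iff_ge mult_nonneg_nonneg zero_le_power2 zero_le_numeral)
  qed
  then have "(\<Sum>x\<in>S. 3 * m ^ 2 * a x - 2 * m ^ 3) \<le> (\<Sum>x\<in>S. a x ^ 3)"
    using assms by (intro sum_mono) auto
  moreover have "(\<Sum>x\<in>S. 3 * m ^ 2 * a x - 2 * m ^ 3) = ?n * m ^ 3"
    unfolding sum_subtractf sum_distrib_left[symmetric] s
    by (simp add: power2_eq_square power3_eq_cube algebra_simps)
  ultimately have "?n ^ 2 * (?n * m ^ 3) \<le> ?n ^ 2 * (\<Sum>x\<in>S. a x ^ 3)"
    by (intro mult_left_mono) auto
  then show ?thesis unfolding s by (simp add: power2_eq_square power3_eq_cube algebra_simps)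
qed

lemma cauchy_schwarz_complex:
  fixes a b :: "'i \<Rightarrow> complex"
  shows "(cmod (\<Sum>i\<in>I. a i * b i))\<^sup>2 \<le> (\<Sum>i\<in>I. (cmod (a i))\<^sup>2) * (\<Sum>i\<in>I. (cmod (b i))\<^sup>2)"
proof -
  have "cmod (\<Sum>i\<in>I. a i * b i) \<le> (\<Sum>i\<in>I. cmod (a i) * cmod (b i))"
    using norm_sum[of "\<lambda>i. a i * b i" I] by (simp add: norm_mult)
  then have "(cmod (\<Sum>i\<in>I. a i * b i))\<^sup>2 \<le> (\<Sum>i\<in>I. cmod (a i) * cmod (b i))\<^sup>2"
    by (intro power_mono) auto
  also have "\<dots> \<le> (\<Sum>i\<in>I. (cmod (a i))\<^sup>2) * (\<Sum>i\<in>I. (cmod (b i))\<^sup>2)"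
    by (rule Cauchy_Schwarz_ineq_sum)
  finally show ?thesis .
qed

lemma log2_ge_ln: "x \<ge> 1 \<Longrightarrow> ln x \<le> log 2 x"
  using ln_le_minus_one[of "2::real"] by (simp add: log_def le_divide_eq mult_left_le)

lemma power_powr:
  fixes x :: real
  assumes "x > 0"
  shows "(x ^ n) powr a = x powr (real n * a)"
  using assms by (metis powr_powr powr_realpow)

text \<open>The summands on the left come from the large and the small values of the exponential
  sum; expanding the second leaves three monomials. Against the target the first two have surplus
  powers p^(1/10) and p^(1/5), which \<open>hyp\<close> bounds, and the third has p^(-1/5), where
  t^3 \<le> p^2 helps. All three have a surplus power of E, controlled by \<open>E2\<close>.\<close>

lemma moment_bound_comparison:
  fixes t p E L Lam K c1 c2 :: real
  assumes t: "t \<ge> 1" and p: "p > 0" and E: "E > 0" and L: "1 \<le> L" "L \<le> t" and Lam: "Lam > 0" "Lam \<le> c1 * L"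
    and K: "K > 0" and c: "c1 \<ge> 1" "c2 \<ge> 1"
    and tp: "t ^ 3 \<le> p ^ 2" and E2: "E ^ 2 \<le> c2 * t ^ 5 * L" and hyp: "p ^ 10 \<le> K * t ^ 22 * E ^ 2 * L ^ 9"
  shows "(2 ^ 37 * Lam ^ 2 * t ^ 7 * p ^ 2) powr (3/10) * (p * E) powr (7/10) * Lam
      + (2 ^ 37 * Lam * (t ^ 5 * p ^ 2 + t ^ 9)) powr (1/5) * (p * E)
    \<le> 3 * exp (100 * (1 + ln c1 + ln c2 + \<bar>ln K\<bar>)) * (t powr (16/5) * E powr (2/5) * p powr (6/5) * L powr (9/5))"
proof -
  \<comment> \<open>In the logarithms of all quantities the claim is linear arithmetic.\<close>
  define T P e l m where "T = ln t" "P = ln p" "e = ln E" "l = ln L" "m = ln Lam"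
  define k a b where "k = ln K" "a = ln c1" "b = ln c2"
  have pos: "t > 0" "L > 0" "c1 > 0" "c2 > 0" using t L c by auto
  have ex: "t = exp T" "p = exp P" "E = exp e" "L = exp l" "Lam = exp m" "K = exp k" "c1 = exp a" "c2 = exp b"
    using pos p E Lam K by (simp_all add: T_P_e_l_m_def k_a_b_def)
  have "0 \<le> l" "l \<le> T" using L t unfolding T_P_e_l_m_def by (auto intro: ln_ge_zero)
  have ab: "0 \<le> a" "0 \<le> b" using c by (auto simp: k_a_b_def)
  have m: "m \<le> a + l" using Lam(2) unfolding ex by (simp flip: exp_add)
  have 1: "3 * T \<le> 2 * P" using tp unfolding ex by (simp flip: exp_of_nat_mult)
  have 2: "2 * e \<le> b + 5 * T + l" using E2 unfolding ex by (simp flip: exp_of_nat_mult exp_add)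
  have 3: "10 * P \<le> k + 22 * T + 2 * e + 9 * l" using hyp unfolding ex by (simp flip: exp_of_nat_mult exp_add)
  let ?c = "100 * (1 + a + b + \<bar>k\<bar>)" and ?w = "16 / 5 * T + 2 / 5 * e + 6 / 5 * P + 9 / 5 * l"
  have l2: "ln 2 \<le> (1::real)" using ln_le_minus_one[of "2::real"] by simp
  have two: "(2::real) ^ 37 = exp (37 * ln 2)" by (simp add: exp_of_nat_mult[of 37 "ln 2 :: real", simplified])
  have "exp m * ((2 ^ 37 * exp m ^ 2 * exp T ^ 7 * exp P ^ 2) powr (3/10) * (exp P * exp e) powr (7/10))
     = exp (m + ((37 * ln 2 + 2 * m + 7 * T + 2 * P) * (3/10) + (P + e) * (7/10)))"
    unfolding two by (simp add: powr_def flip: exp_of_nat_mult exp_add)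
  also have "\<dots> \<le> exp (?c + ?w)"
  proof -
    have "k \<le> \<bar>k\<bar>" by simp
    have "m + ((37 * ln 2 + 2 * m + 7 * T + 2 * P) * (3/10) + (P + e) * (7/10)) \<le> ?c + ?w"
      using m 1 2 3 \<open>0 \<le> l\<close> \<open>l \<le> T\<close> ab l2 \<open>k \<le> \<bar>k\<bar>\<close> by argo
    then show ?thesis by simp
  qed
  finally have term1: "exp m * ((2 ^ 37 * exp m ^ 2 * exp T ^ 7 * exp P ^ 2) powr (3/10) * (exp P * exp e) powr (7/10))
     \<le> exp (?c + ?w)" .
  have split: "(x + y) powr (1/5) \<le> (2 * x) powr (1/5) + (2 * y) powr (1/5)" if "x > 0" "y > 0" for x y :: real
  proof (cases "x \<le> y")
    case True
    then have "(x + y) powr (1/5) \<le> (2 * y) powr (1/5)" using that by (intro powr_mono2) auto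
    then show ?thesis by (simp add: add_increasing)
  next
    case False
    then have "(x + y) powr (1/5) \<le> (2 * x) powr (1/5)" using that by (intro powr_mono2) auto
    then show ?thesis by (simp add: add_increasing2)
  qed
  have "(2 ^ 37 * exp m * (exp T ^ 5 * exp P ^ 2 + exp T ^ 9)) powr (1/5)
     \<le> (2 * (2 ^ 37 * exp m * (exp T ^ 5 * exp P ^ 2))) powr (1/5) + (2 * (2 ^ 37 * exp m * exp T ^ 9)) powr (1/5)"
    unfolding distrib_left by (rule split) auto
  also have "(2 * (2 ^ 37 * exp m * (exp T ^ 5 * exp P ^ 2))) powr (1/5) = exp ((38 * ln 2 + m + 5 * T + 2 * P) / 5)"
    unfolding two by (simp add: powr_def ln_mult flip: exp_of_nat_mult exp_add)
  also have "(2 * (2 ^ 37 * exp m * exp T ^ 9)) powr (1/5) = exp ((38 * ln 2 + m + 9 * T) / 5)"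
    unfolding two by (simp add: powr_def ln_mult flip: exp_of_nat_mult exp_add)
  finally have "(2 ^ 37 * exp m * (exp T ^ 5 * exp P ^ 2 + exp T ^ 9)) powr (1/5) * (exp P * exp e)
     \<le> (exp ((38 * ln 2 + m + 5 * T + 2 * P) / 5) + exp ((38 * ln 2 + m + 9 * T) / 5)) * (exp P * exp e)"
    by (intro mult_right_mono) auto
  also have "\<dots> = exp ((38 * ln 2 + m + 5 * T + 2 * P) / 5 + P + e) + exp ((38 * ln 2 + m + 9 * T) / 5 + P + e)"
    by (simp add: exp_add distrib_right)
  also have "\<dots> \<le> exp (?c + ?w) + exp (?c + ?w)"
  proof (intro add_mono)
    have "k \<le> \<bar>k\<bar>" by simp
    have "(38 * ln 2 + m + 5 * T + 2 * P) / 5 + P + e \<le> ?c + ?w"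
      using m 1 2 3 \<open>0 \<le> l\<close> \<open>l \<le> T\<close> ab l2 \<open>k \<le> \<bar>k\<bar>\<close> by argo
    then show "exp ((38 * ln 2 + m + 5 * T + 2 * P) / 5 + P + e) \<le> exp (?c + ?w)" by simp
    have "(38 * ln 2 + m + 9 * T) / 5 + P + e \<le> ?c + ?w"
      using m 1 2 3 \<open>0 \<le> l\<close> \<open>l \<le> T\<close> ab l2 \<open>k \<le> \<bar>k\<bar>\<close> by argo
    then show "exp ((38 * ln 2 + m + 9 * T) / 5 + P + e) \<le> exp (?c + ?w)" by simp
  qed
  finally have "exp m * ((2 ^ 37 * exp m ^ 2 * exp T ^ 7 * exp P ^ 2) powr (3/10) * (exp P * exp e) powr (7/10))
     + (2 ^ 37 * exp m * (exp T ^ 5 * exp P ^ 2 + exp T ^ 9)) powr (1/5) * (exp P * exp e)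
     \<le> 3 * exp (?c + ?w)" using term1 by linarith
  also have "\<dots> = 3 * exp ?c * (exp T powr (16/5) * exp e powr (2/5) * exp P powr (6/5) * exp l powr (9/5))"
    by (simp add: powr_def mult.assoc flip: exp_add)
  finally show ?thesis unfolding ex ln_exp by (simp add: mult_ac)
qed

section \<open>Correlations with a multiplicative subgroup\<close>

text \<open>The group structure is expressed by integer representatives and explicit reduction, so
  that the same numbers can serve as residues, polynomial arguments and frequencies.\<close>

locale residue_subgroup =
  fixes p :: nat and G :: "int set"
  assumes prime_p: "prime p"
    and G_subset: "G \<subseteq> {1..<int p}"
    and one_in_G: "1 \<in> G"
    and G_mult: "\<And>x y. x \<in> G \<Longrightarrow> y \<in> G \<Longrightarrow> x * y mod int p \<in> G"
    and G_inverse: "\<And>x. x \<in> G \<Longrightarrow> \<exists>y\<in>G. x * y mod int p = 1"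
begin

abbreviation "t \<equiv> card G"

text \<open>The unions of cosets of \<open>G\<close> in the multiplicative group, the empty union
  included.\<close>

definition invariant :: "int set \<Rightarrow> bool" where
  "invariant Q \<longleftrightarrow> Q \<subseteq> {1..<int p} \<and> (\<forall>x\<in>G. \<forall>q\<in>Q. x * q mod int p \<in> Q)"

text \<open>This counts the representations of z as a difference of an element of \<open>Q\<close>
  and one of \<open>G\<close>.\<close>

definition conv :: "int set \<Rightarrow> int \<Rightarrow> nat" where
  "conv Q z = card {x \<in> G. (x + z) mod int p \<in> Q}"

definition autocorr :: "int set \<Rightarrow> int \<Rightarrow> nat" where
  "autocorr Q z = card {q \<in> Q. (q + z) mod int p \<in> Q}"

lemma finite_G: "finite G"
  using G_subset finite_subset by blast

lemma t_pos: "t > 0"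
  using finite_G one_in_G card_gt_0_iff by blast

lemma t_less_p: "t < p"
proof -
  have "t \<le> card {1..<int p}" using G_subset by (intro card_mono) auto
  then show ?thesis using prime_gt_0_nat[OF prime_p] by simp
qed

lemma invariant_G: "invariant G"
  using G_subset G_mult by (auto simp: invariant_def)

lemma invariantD:
  assumes "invariant Q"
  shows "finite Q" "Q \<subseteq> {1..<int p}" "0 \<notin> Q"
    "\<And>x q. x \<in> G \<Longrightarrow> q \<in> Q \<Longrightarrow> x * q mod int p \<in> Q"
  using assms finite_subset[of Q] by (auto simp: invariant_def)

lemma not_dvd_residue: "x \<in> {1..<int p} \<Longrightarrow> \<not> int p dvd x"
  using zdvd_not_zless by auto

section \<open>Dilations, translations and cosets\<close>

lemma inj_on_mult_mod:
  assumes "\<not> int p dvd a"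
  shows "inj_on (\<lambda>x. a * x mod int p) {0..<int p}"
proof (rule inj_onI)
  fix x y assume xy: "x \<in> {0..<int p}" "y \<in> {0..<int p}" "a * x mod int p = a * y mod int p"
  then have "int p dvd a * (x - y)" by (simp add: mod_eq_dvd_iff right_diff_distrib)
  then have "int p dvd x - y" using assms prime_p by (simp add: prime_dvd_mult_iff)
  then have "x mod int p = y mod int p" by (simp add: mod_eq_dvd_iff)
  moreover have "x mod int p = x" "y mod int p = y" using xy(1,2) by auto
  ultimately show "x = y" by metis
qed

lemma bij_betw_mult_mod:
  assumes "\<not> int p dvd a"
  shows "bij_betw (\<lambda>x. a * x mod int p) {0..<int p} {0..<int p}"
proof -
  have "(\<lambda>x. a * x mod int p) ` {0..<int p} \<subseteq> {0..<int p}"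
    using prime_gt_0_nat[OF prime_p] by auto
  then show ?thesis
    using inj_on_mult_mod[OF assms] endo_inj_surj[of "{0..<int p}"] by (simp add: bij_betw_def)
qed

lemma bij_betw_add_mod: "bij_betw (\<lambda>x. (x + a) mod int p) {0..<int p} {0..<int p}"
proof -
  have p0: "int p > 0" using prime_gt_0_nat[OF prime_p] by simp
  have "inj_on (\<lambda>x. (x + a) mod int p) {0..<int p}"
  proof (rule inj_onI)
    fix x y assume xy: "x \<in> {0..<int p}" "y \<in> {0..<int p}" "(x + a) mod int p = (y + a) mod int p"
    then have "int p dvd x - y" by (simp add: mod_eq_dvd_iff)
    then have "x mod int p = y mod int p" unfolding mod_eq_dvd_iff .
    moreover have "x mod int p = x" "y mod int p = y" using xy(1,2) by auto
    ultimately show "x = y" by metis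
  qed
  moreover have "(\<lambda>x. (x + a) mod int p) ` {0..<int p} \<subseteq> {0..<int p}" using p0 by auto
  ultimately show ?thesis using endo_inj_surj[of "{0..<int p}"] by (simp add: bij_betw_def)
qed

lemma bij_betw_invariant:
  assumes "invariant Q" "x \<in> G"
  shows "bij_betw (\<lambda>q. x * q mod int p) Q Q"
proof -
  have "\<not> int p dvd x" using assms(2) G_subset not_dvd_residue by blast
  then have "inj_on (\<lambda>q. x * q mod int p) Q"
    by (rule inj_on_subset[OF inj_on_mult_mod]) (use invariantD(2)[OF assms(1)] in auto)
  moreover have "(\<lambda>q. x * q mod int p) ` Q \<subseteq> Q" using invariantD(4)[OF assms(1) assms(2)] by auto
  ultimately show ?thesis
    using endo_inj_surj[OF invariantD(1)[OF assms(1)]] by (simp add: bij_betw_def)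
qed

text \<open>Multiplication by x permutes \<open>G\<close>, so the product over \<open>G\<close>
  equals itself times x^t.\<close>

lemma power_t_eq_1:
  assumes "x \<in> G"
  shows "[x ^ t = 1] (mod int p)"
proof -
  have "(\<Prod>y\<in>G. y) = (\<Prod>y\<in>G. x * y mod int p)"
    using prod.reindex_bij_betw[OF bij_betw_invariant[OF invariant_G assms], of "\<lambda>y. y"] by simp
  moreover have "[(\<Prod>y\<in>G. x * y mod int p) = (\<Prod>y\<in>G. x * y)] (mod int p)"
    by (intro cong_prod) (simp add: cong_def)
  moreover have "(\<Prod>y\<in>G. x * y) = x ^ t * (\<Prod>y\<in>G. y)" by (simp add: prod.distrib)
  ultimately have "[1 * (\<Prod>y\<in>G. y) = x ^ t * (\<Prod>y\<in>G. y)] (mod int p)" by simp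
  moreover have "coprime (\<Prod>y\<in>G. y) (int p)"
  proof (rule prod_coprime_left)
    fix y assume "y \<in> G"
    then have "\<not> int p dvd y" using G_subset not_dvd_residue by blast
    then show "coprime y (int p)"
      using prime_p by (metis coprime_commute prime_imp_coprime prime_nat_int_transfer)
  qed
  ultimately show ?thesis using cong_mult_rcancel cong_sym by blast
qed

lemma card_orbit:
  assumes "q \<in> {1..<int p}"
  shows "card ((\<lambda>x. x * q mod int p) ` G) = t"
proof (rule card_image)
  have "inj_on (\<lambda>x. q * x mod int p) G"
    by (rule inj_on_subset[OF inj_on_mult_mod[OF not_dvd_residue[OF assms]]]) (use G_subset in auto)
  then show "inj_on (\<lambda>x. x * q mod int p) G" by (simp add: mult.commute)
qed

lemma invariant_orbit:
  assumes "q \<in> {1..<int p}"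
  shows "invariant ((\<lambda>x. x * q mod int p) ` G)"
  unfolding invariant_def
proof (intro conjI ballI)
  have "x * q mod int p \<in> {1..<int p}" if "x \<in> G" for x
  proof -
    have "\<not> int p dvd x * q"
      using that assms G_subset not_dvd_residue prime_p by (auto simp: prime_dvd_mult_iff)
    then have "x * q mod int p \<noteq> 0" by (simp add: dvd_eq_mod_eq_0)
    moreover have "0 \<le> x * q mod int p" "x * q mod int p < int p"
      using prime_gt_0_nat[OF prime_p] by auto
    ultimately show ?thesis by simp
  qed
  then show "(\<lambda>x. x * q mod int p) ` G \<subseteq> {1..<int p}" by auto
  fix x y assume "x \<in> G" "y \<in> (\<lambda>x. x * q mod int p) ` G"
  then obtain z where "z \<in> G" "y = z * q mod int p" by auto
  then have "x * y mod int p = (x * z mod int p) * q mod int p"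
    by (metis (no_types, lifting) mod_mult_left_eq mod_mult_right_eq mult.assoc)
  then show "x * y mod int p \<in> (\<lambda>x. x * q mod int p) ` G"
    using G_mult \<open>x \<in> G\<close> \<open>z \<in> G\<close> by blast
qed

lemma t_le_card_invariant:
  assumes "invariant Q" "Q \<noteq> {}"
  shows "t \<le> card Q"
proof -
  obtain q where q: "q \<in> Q" using assms by auto
  then have "(\<lambda>x. x * q mod int p) ` G \<subseteq> Q" using invariantD(4)[OF assms(1)] by auto
  then show ?thesis using card_orbit[of q] invariantD(1,2)[OF assms(1)] q
    by (metis card_mono subset_eq)
qed

text \<open>The map to t-th powers is constant on cosets, so every nonempty fibre in
  \<open>Q\<close> has at least t elements.\<close>

lemma card_powers_invariant:
  assumes "invariant Q"
  shows "t * card ((\<lambda>q. q ^ t mod int p) ` Q) \<le> card Q"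
proof -
  let ?f = "\<lambda>q. q ^ t mod int p"
  have "card Q = (\<Sum>v\<in>?f ` Q. card {q \<in> Q. ?f q = v})"
    using sum.image_gen[OF invariantD(1)[OF assms], of "\<lambda>_. 1::nat" ?f] by simp
  moreover have "t \<le> card {q \<in> Q. ?f q = v}" if v: "v \<in> ?f ` Q" for v
  proof -
    obtain q where q: "q \<in> Q" "v = ?f q" using v by auto
    have "(\<lambda>x. x * q mod int p) ` G \<subseteq> {q \<in> Q. ?f q = v}"
    proof clarify
      fix x assume x: "x \<in> G"
      have "[(x * q mod int p) ^ t = x ^ t * q ^ t] (mod int p)"
        by (simp add: cong_def power_mod flip: power_mult_distrib)
      moreover have "[x ^ t * q ^ t = 1 * q ^ t] (mod int p)"
        using power_t_eq_1[OF x] by (intro cong_mult cong_refl)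
      ultimately have "?f (x * q mod int p) = v" using q by (simp add: cong_def)
      then show "x * q mod int p \<in> Q \<and> ?f (x * q mod int p) = v"
        using invariantD(4)[OF assms x q(1)] by simp
    qed
    then have "card ((\<lambda>x. x * q mod int p) ` G) \<le> card {q \<in> Q. ?f q = v}"
      using invariantD(1)[OF assms] by (intro card_mono) auto
    moreover have "q \<in> {1..<int p}" using q(1) invariantD(2)[OF assms] by blast
    ultimately show ?thesis using card_orbit[of q] by simp
  qed
  ultimately show ?thesis
    using sum_bounded_below[of "?f ` Q" t "\<lambda>v. card {q \<in> Q. ?f q = v}"] by (simp add: mult.commute)
qed

text \<open>The pairs of u^t and (u - 1)^t lie in a product of two sets of t-th powers with at most
  |Q||Z| / t^2 elements. The size hypotheses are those of \<open>stepanov_curves\<close> for this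
  N.\<close>

lemma card_shift_inter:
  assumes Q: "invariant Q" and Z: "invariant Z"
    and small: "8 * (card Q * card Z) < t ^ 4" "64 * (card Q * card Z) * t\<^sup>2 \<le> p ^ 3"
  shows "t\<^sup>2 * card {u \<in> Q. (u - 1) mod int p \<in> Z} ^ 3 \<le> 32768 * (card Q * card Z)\<^sup>2"
proof (cases "Q = {} \<or> Z = {}")
  case False
  let ?f = "\<lambda>q. q ^ t mod int p"
  let ?P = "?f ` Q \<times> ?f ` Z" and ?S = "{u \<in> Q. (u - 1) mod int p \<in> Z}"
  define N where "N = card (?f ` Q) * card (?f ` Z)"
  have Nt: "N * t\<^sup>2 \<le> card Q * card Z"
    using mult_le_mono[OF card_powers_invariant[OF Q] card_powers_invariant[OF Z]]
    by (simp add: N_def power2_eq_square mult_ac)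
  have "N \<ge> 1" using False invariantD(1)[OF Q] invariantD(1)[OF Z]
    by (simp add: N_def Suc_le_eq card_gt_0_iff)
  have S: "?S \<subseteq> {2..<int p}"
  proof
    fix u assume u: "u \<in> ?S"
    then have "u \<noteq> 1" using invariantD(3)[OF Z] by auto
    then show "u \<in> {2..<int p}" using u invariantD(2)[OF Q] by auto
  qed
  have "card ?S ^ 3 \<le> 32768 * t\<^sup>2 * N\<^sup>2"
  proof (rule stepanov_curves[OF prime_p _ _ S _ \<open>N \<ge> 1\<close>])
    show "finite ?P" using invariantD(1)[OF Q] invariantD(1)[OF Z] by simp
    show "card ?P \<le> N" by (simp add: N_def card_cartesian_product)
    show "(u ^ t mod int p, (u - 1) ^ t mod int p) \<in> ?P" if "u \<in> ?S" for u
    proof -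
      have "(u - 1) mod int p = u - 1" using that S by auto
      then show ?thesis using that by auto
    qed
    have "8 * N * t\<^sup>2 \<le> 8 * (card Q * card Z)" using Nt by simp
    also have "\<dots> < t\<^sup>2 * t\<^sup>2" using small by (simp flip: power_add)
    finally show "8 * N < t\<^sup>2" by (rule mult_less_cancel2[THEN iffD1, THEN conjunct2])
    have "64 * N * t ^ 4 = 64 * (N * t\<^sup>2) * t\<^sup>2" by (simp flip: power_add)
    also have "\<dots> \<le> 64 * (card Q * card Z) * t\<^sup>2" using Nt by (intro mult_le_mono1 mult_le_mono2)
    finally show "64 * N * t ^ 4 \<le> p ^ 3" using small by simp
    show "t \<le> p" using t_less_p by simp
  qed
  then have "t\<^sup>2 * card ?S ^ 3 \<le> t\<^sup>2 * (32768 * t\<^sup>2 * N\<^sup>2)" by simp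
  also have "\<dots> = 32768 * (N * t\<^sup>2)\<^sup>2" by (simp add: power2_eq_square)
  also have "\<dots> \<le> 32768 * (card Q * card Z)\<^sup>2" using Nt by (intro mult_le_mono2 power_mono) auto
  finally show ?thesis .
qed auto

text \<open>Dividing x + z = q by x gives u = q / x in \<open>Q\<close> with u - 1 = z / x in
  \<open>Z\<close>, and x together with u determines z.\<close>

lemma sum_conv_le:
  assumes Q: "invariant Q" and Z: "invariant Z"
  shows "(\<Sum>z\<in>Z. conv Q z) \<le> t * card {u \<in> Q. (u - 1) mod int p \<in> Z}"
proof -
  let ?M = "{u \<in> Q. (u - 1) mod int p \<in> Z}"
  let ?L = "SIGMA z:Z. {x \<in> G. (x + z) mod int p \<in> Q}"
  obtain iv where iv: "\<And>x. x \<in> G \<Longrightarrow> iv x \<in> G \<and> x * iv x mod int p = 1"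
    using G_inverse by metis
  define F where "F = (\<lambda>(z, x). (x, iv x * (x + z) mod int p))"
  have "(\<Sum>z\<in>Z. conv Q z) = card ?L"
    unfolding conv_def using invariantD(1)[OF Z] finite_G by simp
  also have "\<dots> \<le> card (G \<times> ?M)"
  proof (rule card_inj_on_le[of F])
    show "inj_on F ?L"
    proof (rule inj_onI)
      fix a b assume ab: "a \<in> ?L" "b \<in> ?L" "F a = F b"
      obtain z x z' x' where e: "a = (z, x)" "b = (z', x')" by fastforce
      have x: "x' = x" "x \<in> G" "z \<in> Z" "z' \<in> Z" and
        eq: "iv x * (x + z) mod int p = iv x * (x + z') mod int p"
        using ab e by (auto simp: F_def)
      have "\<not> int p dvd iv x" using iv[OF x(2)] G_subset not_dvd_residue by blast
      moreover have "int p dvd iv x * (z - z')"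
        using eq by (simp add: mod_eq_dvd_iff algebra_simps)
      ultimately have "int p dvd z - z'" using prime_p by (simp add: prime_dvd_mult_iff)
      then have "z mod int p = z' mod int p" by (simp add: mod_eq_dvd_iff)
      moreover have "z mod int p = z" "z' mod int p = z'"
        using x(3,4) invariantD(2)[OF Z] by (auto intro!: mod_pos_pos_trivial)
      ultimately show "a = b" using e x(1) by simp
    qed
    show "F ` ?L \<subseteq> G \<times> ?M"
    proof (rule image_subsetI)
      fix a assume "a \<in> ?L"
      then obtain z x where a: "a = (z, x)" and zx: "z \<in> Z" "x \<in> G" "(x + z) mod int p \<in> Q"
        by auto
      have i: "iv x \<in> G" "x * iv x mod int p = 1" using iv zx by auto
      have "iv x * (x + z) mod int p = iv x * ((x + z) mod int p) mod int p"
        by (simp add: mod_mult_right_eq)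
      then have "iv x * (x + z) mod int p \<in> Q" using invariantD(4)[OF Q i(1) zx(3)] by simp
      moreover have "(iv x * (x + z) mod int p - 1) mod int p = iv x * z mod int p"
      proof -
        have "[iv x * (x + z) = 1 + iv x * z] (mod int p)"
        proof -
          have "[x * iv x + iv x * z = 1 + iv x * z] (mod int p)"
            using i(2) prime_gt_1_nat[OF prime_p] by (intro cong_add cong_refl) (simp add: cong_def)
          then show ?thesis by (simp add: algebra_simps)
        qed
        then have "[iv x * (x + z) - 1 = iv x * z] (mod int p)"
          by (metis add_diff_cancel_left' cong_diff cong_refl)
        then show ?thesis by (simp add: cong_def mod_diff_left_eq)
      qed
      then have "(iv x * (x + z) mod int p - 1) mod int p \<in> Z"
        using invariantD(4)[OF Z i(1) zx(1)] by simp
      ultimately show "F a \<in> G \<times> ?M" using zx a by (simp add: F_def)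
    qed
    show "finite (G \<times> ?M)" using finite_G invariantD(1)[OF Q] by simp
  qed
  also have "\<dots> = t * card ?M" by (simp add: card_cartesian_product)
  finally show ?thesis .
qed

section \<open>Level sets and third moment of the correlation\<close>

lemma conv_le_t: "conv Q z \<le> t"
  unfolding conv_def using finite_G by (intro card_mono) auto

lemma conv_mult_ge:
  assumes Q: "invariant Q" and y: "y \<in> G"
  shows "conv Q z \<le> conv Q (y * z mod int p)"
  unfolding conv_def
proof (rule card_inj_on_le)
  show "inj_on (\<lambda>x. y * x mod int p) {x \<in> G. (x + z) mod int p \<in> Q}"
    using bij_betw_invariant[OF invariant_G y] by (auto simp: bij_betw_def inj_on_def)
  show "(\<lambda>x. y * x mod int p) ` {x \<in> G. (x + z) mod int p \<in> Q}
      \<subseteq> {x \<in> G. (x + y * z mod int p) mod int p \<in> Q}"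
  proof clarify
    fix x assume x: "x \<in> G" "(x + z) mod int p \<in> Q"
    have "(y * x mod int p + y * z mod int p) mod int p = y * ((x + z) mod int p) mod int p"
      by (simp add: mod_simps distrib_left)
    then show "y * x mod int p \<in> G \<and> (y * x mod int p + y * z mod int p) mod int p \<in> Q"
      using x y G_mult invariantD(4)[OF Q y x(2)] by simp
  qed
qed (use finite_G in auto)

lemma invariant_level_set:
  assumes "invariant Q"
  shows "invariant {z \<in> {1..<int p}. s \<le> conv Q z}"
  unfolding invariant_def
proof (intro conjI ballI)
  fix x z assume x: "x \<in> G" and z: "z \<in> {z \<in> {1..<int p}. s \<le> conv Q z}"
  then have "x * z mod int p \<in> {1..<int p}"
    using invariantD(2)[OF invariant_orbit[of z]] by auto
  moreover have "s \<le> conv Q (x * z mod int p)"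
    using z conv_mult_ge[OF assms x, of z] by simp
  ultimately show "x * z mod int p \<in> {z \<in> {1..<int p}. s \<le> conv Q z}" by simp
qed auto

text \<open>Cosets have t elements, so a largest union of cosets of size at most b is either all of
  \<open>Z\<close> or within t of b. It may be empty if b < t.\<close>

lemma exists_invariant_subset:
  fixes b :: real
  assumes Z: "invariant Z" and b: "b \<ge> 0"
  obtains Y where "Y \<subseteq> Z" "invariant Y" "real (card Y) \<le> b" "Y = Z \<or> b < real (card Y) + real t"
proof -
  let ?C = "{Y. Y \<subseteq> Z \<and> invariant Y \<and> real (card Y) \<le> b}"
  have fin: "finite ?C" using invariantD(1)[OF Z] by simp
  have "{} \<in> ?C" using b by (simp add: invariant_def)
  then have "?C \<noteq> {}" by blast
  then obtain Y where Y1: "Y \<in> ?C" "Max (card ` ?C) = card Y" using obtains_MAX[OF fin] by blast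
  have Y: "Y \<in> ?C" "\<And>X. X \<in> ?C \<Longrightarrow> card X \<le> card Y"
    using Y1 Max_ge[of "card ` ?C"] fin by auto
  show ?thesis
  proof (rule that)
    show "Y = Z \<or> b < real (card Y) + real t"
    proof (rule ccontr)
      assume n: "\<not> ?thesis"
      then obtain z where z: "z \<in> Z" "z \<notin> Y" using Y by blast
      let ?O = "(\<lambda>x. x * z mod int p) ` G"
      have zp: "z \<in> {1..<int p}" using z invariantD(2)[OF Z] by auto
      have "card (Y \<union> ?O) \<le> card Y + t" using card_Un_le[of Y ?O] card_orbit[OF zp] by simp
      then have "real (card (Y \<union> ?O)) \<le> b" using n by linarith
      moreover have "invariant (Y \<union> ?O)"
        using Y(1) invariant_orbit[OF zp] by (auto simp: invariant_def)
      moreover have "?O \<subseteq> Z" using invariantD(4)[OF Z] z by auto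
      ultimately have "card (Y \<union> ?O) \<le> card Y" using Y by auto
      moreover have "z \<in> ?O" using one_in_G zp by (force intro!: image_eqI[of _ _ 1])
      then have "Y \<subset> Y \<union> ?O" using z by auto
      then have "card Y < card (Y \<union> ?O)"
        using Y(1) finite_G invariantD(1) by (intro psubset_card_mono) auto
      ultimately show False by simp
    qed
  qed (use Y in auto)
qed

text \<open>With m the count in \<open>card_shift_inter\<close>, s|Y| \<le> tm while m^3 is of order
  (|Q||Y| / t)^2 or less; cubing the first and dividing by |Y|^2 gives the claim.\<close>

lemma conv_level_set_small:
  assumes Q: "invariant Q" and Y: "invariant Y"
    and ge: "\<And>z. z \<in> Y \<Longrightarrow> s \<le> conv Q z"
    and small: "8 * (card Q * card Y) < t ^ 4" "64 * (card Q * card Y) * t\<^sup>2 \<le> p ^ 3"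
  shows "s ^ 3 * card Y \<le> 32768 * t * (card Q)\<^sup>2"
proof (cases "card Y = 0")
  case False
  let ?m = "card {u \<in> Q. (u - 1) mod int p \<in> Y}"
  have "s * card Y \<le> (\<Sum>z\<in>Y. conv Q z)"
    using sum_bounded_below[of Y s "conv Q"] ge by (simp add: mult.commute)
  also have "\<dots> \<le> t * ?m" by (rule sum_conv_le[OF Q Y])
  finally have "(s * card Y) ^ 3 \<le> (t * ?m) ^ 3" by (rule power_mono) simp
  then have "s ^ 3 * card Y ^ 3 \<le> t ^ 3 * ?m ^ 3" by (simp only: power_mult_distrib)
  then have "t\<^sup>2 * (s ^ 3 * card Y ^ 3) \<le> t\<^sup>2 * (t ^ 3 * ?m ^ 3)" by (rule mult_le_mono2)
  also have "\<dots> = t ^ 3 * (t\<^sup>2 * ?m ^ 3)" by simp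
  also have "\<dots> \<le> t ^ 3 * (32768 * (card Q * card Y)\<^sup>2)"
    by (intro mult_le_mono2 card_shift_inter Q Y small)
  finally have "(t\<^sup>2 * (card Y)\<^sup>2) * (s ^ 3 * card Y) \<le> (t\<^sup>2 * (card Y)\<^sup>2) * (32768 * t * (card Q)\<^sup>2)"
    by (simp add: power2_eq_square power3_eq_cube mult_ac)
  then show ?thesis using False t_pos by simp
qed simp

text \<open>For an inadmissibly large level set, the bound on an admissible part already contradicts
  \<open>large\<close>. The constant 256 leaves room over the cube roots of 2^20 and 2^22 that arise
  below.\<close>

lemma conv_level_set:
  fixes Q z
  defines "s \<equiv> conv Q z" and "Z \<equiv> {w \<in> {1..<int p}. conv Q z \<le> conv Q w}"
  assumes Q: "invariant Q" "Q \<noteq> {}" and tp: "t ^ 3 \<le> p\<^sup>2"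
    and large: "real s > 256 * real (card Q) * (1 / real t + real t / real p)"
  shows "real s ^ 3 * real (card Z) \<le> 32768 * real t * (real (card Q))\<^sup>2"
proof -
  let ?q = "real (card Q)" and ?t = "real t" and ?p = "real p" and ?s = "real s"
  have q: "?q > 0" using Q invariantD(1) by (simp add: card_gt_0_iff)
  have t: "?t > 0" using t_pos by simp
  have p: "?p > 0" using prime_gt_0_nat[OF prime_p] by simp
  have Z: "invariant Z" unfolding Z_def by (rule invariant_level_set[OF Q(1)])
  \<comment> \<open>The two entries of the minimum are the two size conditions of
    \<open>conv_level_set_small\<close>; 16 in place of 8 makes the first one strict.\<close>
  define b where "b = min (?t ^ 4 / 16) (?p ^ 3 / (64 * ?t\<^sup>2)) / ?q"
  have b0: "b > 0" using q t p by (simp add: b_def)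
  then obtain Y where Y: "Y \<subseteq> Z" "invariant Y" "real (card Y) \<le> b" "Y = Z \<or> b < real (card Y) + ?t"
    using exists_invariant_subset[OF Z, of b] by auto
  have qY: "?q * real (card Y) \<le> ?t ^ 4 / 16" "?q * real (card Y) \<le> ?p ^ 3 / (64 * ?t\<^sup>2)"
    using Y(3) q by (auto simp: b_def field_simps)
  have "s ^ 3 * card Y \<le> 32768 * t * (card Q)\<^sup>2"
  proof (rule conv_level_set_small[OF Q(1) Y(2)])
    show "s \<le> conv Q w" if "w \<in> Y" for w using that Y(1) by (auto simp: Z_def s_def)
    have "8 * (?q * real (card Y)) < ?t ^ 4"
      using qY(1) zero_less_power[OF t, of 4] by linarith
    then have "real (8 * (card Q * card Y)) < real (t ^ 4)" by simp
    then show "8 * (card Q * card Y) < t ^ 4" unfolding of_nat_less_iff .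
    have "64 * (?q * real (card Y)) * ?t\<^sup>2 \<le> ?p ^ 3"
      using qY(2) t by (simp add: field_simps)
    then have "real (64 * (card Q * card Y) * t\<^sup>2) \<le> real (p ^ 3)" by simp
    then show "64 * (card Q * card Y) * t\<^sup>2 \<le> p ^ 3" unfolding of_nat_le_iff .
  qed
  then have "real (s ^ 3 * card Y) \<le> real (32768 * t * (card Q)\<^sup>2)" unfolding of_nat_le_iff .
  then have main: "?s ^ 3 * real (card Y) \<le> 32768 * ?t * ?q\<^sup>2" by simp
  show ?thesis
  proof (cases "Y = Z")
    case True
    then show ?thesis using main by simp
  next
    case False
    then have bY: "b < real (card Y) + ?t" using Y(4) by simp
    have "?s \<le> 256 * ?q * (1 / ?t + ?t / ?p)"
    proof (cases "Y = {}")
      case True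
      \<comment> \<open>Not even a single coset is admissible. Then the threshold is at least t,
        which bounds every correlation.\<close>
      then have "b < ?t" using bY by simp
      then have "min (?t ^ 4 / 16) (?p ^ 3 / (64 * ?t\<^sup>2)) < ?t * ?q"
        using q by (simp add: b_def field_simps)
      then consider "?t ^ 4 / 16 < ?t * ?q" | "?p ^ 3 / (64 * ?t\<^sup>2) < ?t * ?q" by (auto simp: min_def split: if_splits)
      then have "?t \<le> 256 * ?q * (1 / ?t + ?t / ?p)"
      proof cases
        case 1
        then have "?t ^ 3 < 16 * ?q" using t by (simp add: eval_nat_numeral)
        moreover have "?t ^ 2 \<le> ?t ^ 3" using t_pos by (intro power_increasing) auto
        ultimately have "?t\<^sup>2 \<le> 256 * ?q" using q by linarith
        then have "?t \<le> 256 * ?q * (1 / ?t)" using t by (simp add: field_simps power2_eq_square)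
        also have "\<dots> \<le> 256 * ?q * (1 / ?t + ?t / ?p)" using q t p by (intro mult_left_mono) auto
        finally show ?thesis .
      next
        case 2
        then have "?p ^ 3 < 64 * ?t ^ 3 * ?q" using t by (simp add: field_simps power2_eq_square power3_eq_cube)
        also have "\<dots> \<le> 64 * ?p\<^sup>2 * ?q"
        proof -
          have "real (t ^ 3) \<le> real (p\<^sup>2)" using tp unfolding of_nat_le_iff .
          then show ?thesis using q by simp
        qed
        finally have "?p < 64 * ?q" using p by (simp add: power2_eq_square power3_eq_cube)
        then have "?t * ?p \<le> ?t * (256 * ?q)" using t q by (intro mult_left_mono) auto
        then have "?t \<le> 256 * ?q * (?t / ?p)" using p by (simp add: field_simps)
        also have "\<dots> \<le> 256 * ?q * (1 / ?t + ?t / ?p)" using q t p by (intro mult_left_mono) auto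
        finally show ?thesis .
      qed
      moreover have "?s \<le> ?t" using conv_le_t by (simp add: s_def)
      ultimately show ?thesis by simp
    next
      case False
      then have "?t \<le> real (card Y)" using t_le_card_invariant[OF Y(2)] by simp
      \<comment> \<open>A nonempty Y contains a coset, hence at least half of the admissible size,
        and the bound for Y becomes a bound for s alone.\<close>
      then have "b \<le> 2 * real (card Y)" using bY by simp
      then have "?s ^ 3 * b \<le> ?s ^ 3 * (2 * real (card Y))" by (intro mult_left_mono) auto
      also have "\<dots> \<le> 65536 * ?t * ?q\<^sup>2" using main by (simp add: mult_ac)
      finally have sb: "?s ^ 3 * min (?t ^ 4 / 16) (?p ^ 3 / (64 * ?t\<^sup>2)) \<le> 65536 * ?t * ?q ^ 3"
        using q by (simp add: b_def field_simps power2_eq_square power3_eq_cube)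
      consider "?s ^ 3 * (?t ^ 4 / 16) \<le> 65536 * ?t * ?q ^ 3"
        | "?s ^ 3 * (?p ^ 3 / (64 * ?t\<^sup>2)) \<le> 65536 * ?t * ?q ^ 3"
        using sb by (auto simp: min_def split: if_splits)
      then show ?thesis
      proof cases
        case 1
        then have "?t * (?s * ?t) ^ 3 \<le> ?t * (1048576 * ?q ^ 3)"
          by (simp add: power_mult_distrib eval_nat_numeral mult_ac)
        then have "(?s * ?t) ^ 3 \<le> 1048576 * ?q ^ 3" using t by simp
        also have "\<dots> \<le> (256 * ?q) ^ 3" using q by (simp add: power_mult_distrib)
        finally have "(?s * ?t) ^ 3 \<le> (256 * ?q) ^ 3" .
        then have "?s * ?t \<le> 256 * ?q" by (rule power_mono_iff[THEN iffD1, rotated 3]) auto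
        then have "?s \<le> 256 * ?q * (1 / ?t)" using t by (simp add: field_simps)
        also have "\<dots> \<le> 256 * ?q * (1 / ?t + ?t / ?p)" using q t p by (intro mult_left_mono) auto
        finally show ?thesis .
      next
        case 2
        then have "(?s * ?p) ^ 3 \<le> 4194304 * (?q * ?t) ^ 3"
          using t by (simp add: power_mult_distrib field_simps power2_eq_square power3_eq_cube)
        also have "\<dots> \<le> (256 * (?q * ?t)) ^ 3" using q t by (simp add: power_mult_distrib)
        finally have "(?s * ?p) ^ 3 \<le> (256 * (?q * ?t)) ^ 3" .
        then have "?s * ?p \<le> 256 * (?q * ?t)" by (rule power_mono_iff[THEN iffD1, rotated 3]) auto
        then have "?s \<le> 256 * ?q * (?t / ?p)" using p by (simp add: field_simps)
        also have "\<dots> \<le> 256 * ?q * (1 / ?t + ?t / ?p)" using q t p by (intro mult_left_mono) auto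
        finally show ?thesis .
      qed
    qed
    then show ?thesis using large by simp
  qed
qed

lemma sum_conv_total:
  assumes "Q \<subseteq> {0..<int p}"
  shows "(\<Sum>z\<in>{0..<int p}. conv Q z) \<le> t * card Q"
proof -
  let ?R = "{0..<int p}"
  have "(\<Sum>z\<in>?R. conv Q z) = (\<Sum>z\<in>?R. \<Sum>x\<in>G. if (x + z) mod int p \<in> Q then 1 else 0)"
    unfolding conv_def using finite_G by (simp add: sum.If_cases Int_def)
  also have "\<dots> = (\<Sum>x\<in>G. \<Sum>z\<in>?R. if (x + z) mod int p \<in> Q then 1 else 0)" by (rule sum.swap)
  also have "\<dots> = (\<Sum>x\<in>G. card Q)"
  proof (rule sum.cong[OF refl])
    fix x assume "x \<in> G"
    have "(\<Sum>z\<in>?R. if (x + z) mod int p \<in> Q then 1 else 0) = (\<Sum>z\<in>?R. if z \<in> Q then 1 else (0::nat))"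
      using sum.reindex_bij_betw[OF bij_betw_add_mod[of x], of "\<lambda>z. if z \<in> Q then 1 else (0::nat)"]
      by (simp add: add.commute)
    also have "\<dots> = card Q" using assms by (simp add: sum.If_cases Int_absorb2 Int_commute)
    finally show "(\<Sum>z\<in>?R. if (x + z) mod int p \<in> Q then 1 else 0) = card Q" .
  qed
  finally show ?thesis by simp
qed

text \<open>Above the threshold T, \<open>conv_level_set\<close> is the rank condition of
  \<open>sum_le_by_rank\<close>. Below it, c^3 \<le> T^2 c and the first moment t|Q| give the last
  two terms, with 131072 = 2 * 256^2.\<close>

lemma sum_conv_cubed:
  assumes Q: "invariant Q" "Q \<noteq> {}" and tp: "t ^ 3 \<le> p\<^sup>2"
  shows "(\<Sum>z\<in>{0..<int p}. real (conv Q z) ^ 3)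
     \<le> 131072 * (real t * real (card Q) ^ 2 * (1 + ln (real t) + ln (real (card Q)))
          + real (card Q) ^ 3 / real t + real (card Q) ^ 3 * real t ^ 3 / real p ^ 2)"
proof -
  let ?q = "real (card Q)" and ?t = "real t" and ?p = "real p"
  let ?R = "{1..<int p}"
  define c where "c z = real (conv Q z)" for z
  define T where "T = 256 * ?q * (1 / ?t + ?t / ?p)"
  have q: "?q \<ge> ?t" using t_le_card_invariant[OF Q] by simp
  have t: "?t \<ge> 1" using t_pos by simp
  have p: "?p > 0" using prime_gt_0_nat[OF prime_p] by simp
  have T0: "T > 0" using q t p unfolding T_def by (intro mult_pos_pos add_pos_pos) auto
  have tot: "(\<Sum>z\<in>{0..<int p}. c z) \<le> ?t * ?q"
  proof -
    have "real (\<Sum>z\<in>{0..<int p}. conv Q z) \<le> real (t * card Q)"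
      unfolding of_nat_le_iff by (rule sum_conv_total) (use invariantD(2)[OF Q(1)] in auto)
    then show ?thesis by (simp add: c_def)
  qed
  define H where "H = {z \<in> ?R. T < c z}"
  define L where "L = {z \<in> ?R. c z \<le> T}"
  have low: "(\<Sum>z\<in>L. c z ^ 3) \<le> T\<^sup>2 * (?t * ?q)"
  proof -
    have "(\<Sum>z\<in>L. c z ^ 3) \<le> (\<Sum>z\<in>L. T\<^sup>2 * c z)"
    proof (rule sum_mono)
      fix z assume "z \<in> L"
      then have "(c z)\<^sup>2 \<le> T\<^sup>2" by (intro power_mono) (auto simp: L_def c_def)
      then show "c z ^ 3 \<le> T\<^sup>2 * c z"
        by (simp add: power3_eq_cube power2_eq_square c_def mult_right_mono)
    qed
    also have "\<dots> \<le> (\<Sum>z\<in>{0..<int p}. T\<^sup>2 * c z)"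
      by (rule sum_mono2) (auto simp: L_def c_def)
    also have "\<dots> \<le> T\<^sup>2 * (?t * ?q)" using tot by (simp add: mult_left_mono flip: sum_distrib_left)
    finally show ?thesis .
  qed
  have T2: "T\<^sup>2 * (?t * ?q) \<le> 131072 * (?q ^ 3 / ?t + ?q ^ 3 * ?t ^ 3 / ?p\<^sup>2)"
  proof -
    have sq: "(a + b)\<^sup>2 \<le> 2 * (a\<^sup>2 + b\<^sup>2)" for a b :: real
      using zero_le_power2[of "a - b"] by (simp add: power2_eq_square algebra_simps)
    have "T\<^sup>2 * (?t * ?q) = 65536 * ?q ^ 3 * ?t * (1 / ?t + ?t / ?p)\<^sup>2"
      by (simp add: T_def power_mult_distrib power2_eq_square power3_eq_cube)
    also have "\<dots> \<le> 65536 * ?q ^ 3 * ?t * (2 * ((1 / ?t)\<^sup>2 + (?t / ?p)\<^sup>2))"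
      using t by (intro mult_left_mono sq) auto
    also have "\<dots> = 131072 * (?q ^ 3 / ?t + ?q ^ 3 * ?t ^ 3 / ?p\<^sup>2)"
      using t p by (simp add: field_simps power2_eq_square power3_eq_cube)
    finally show ?thesis .
  qed
  have lnq: "ln ?t \<ge> 0" "ln ?q \<ge> 0" using t q by auto
  have high: "(\<Sum>z\<in>H. c z ^ 3) \<le> 32768 * ?t * ?q\<^sup>2 * (1 + ln ?t + ln ?q)"
  proof (cases "H = {}")
    case True
    then show ?thesis using lnq t by simp
  next
    case False
    have fin: "finite H" by (rule finite_subset[of _ ?R]) (auto simp: H_def)
    have "(\<Sum>z\<in>H. c z ^ 3) \<le> 32768 * ?t * ?q\<^sup>2 * (1 + ln (real (card H)))"
    proof (rule sum_le_by_rank[OF fin False])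
      show "c z ^ 3 \<ge> 0" for z by (simp add: c_def)
      fix z assume z: "z \<in> H"
      have "card {y \<in> H. c z ^ 3 \<le> c y ^ 3} \<le> card {w \<in> ?R. conv Q z \<le> conv Q w}"
        by (intro card_mono finite_subset[of "{w \<in> ?R. conv Q z \<le> conv Q w}" ?R])
          (auto simp: H_def c_def power_mono_iff)
      then have "c z ^ 3 * real (card {y \<in> H. c z ^ 3 \<le> c y ^ 3})
          \<le> c z ^ 3 * real (card {w \<in> ?R. conv Q z \<le> conv Q w})"
        by (intro mult_left_mono) (auto simp: c_def)
      also have "\<dots> \<le> 32768 * ?t * ?q\<^sup>2"
        unfolding c_def using z by (intro conv_level_set[OF Q tp]) (auto simp: H_def T_def c_def)
      finally show "c z ^ 3 * real (card {y \<in> H. c z ^ 3 \<le> c y ^ 3}) \<le> 32768 * ?t * ?q\<^sup>2" .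
    qed
    also have "\<dots> \<le> 32768 * ?t * ?q\<^sup>2 * (1 + (ln ?t + ln ?q))"
    proof -
      \<comment> \<open>The correlation is a positive integer on H, so the first moment bounds the
        size of H. The logarithm thus involves t and |Q| only.\<close>
      have "real (card H) \<le> (\<Sum>z\<in>H. c z)"
      proof -
        have "(\<Sum>z\<in>H. 1) \<le> (\<Sum>z\<in>H. c z)"
        proof (rule sum_mono)
          fix z assume "z \<in> H"
          then have "real (conv Q z) > 0" using T0 by (auto simp: H_def c_def)
          then show "1 \<le> c z" by (simp add: c_def)
        qed
        then show ?thesis by simp
      qed
      also have "\<dots> \<le> (\<Sum>z\<in>{0..<int p}. c z)"
        by (rule sum_mono2) (auto simp: H_def c_def)
      finally have "real (card H) \<le> ?t * ?q" using tot by simp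
      moreover have "real (card H) > 0" using False fin by (simp add: card_gt_0_iff)
      ultimately have "ln (real (card H)) \<le> ln (?t * ?q)" by simp
      also have "\<dots> = ln ?t + ln ?q" using t q by (simp add: ln_mult)
      finally show ?thesis using t by (intro mult_left_mono) auto
    qed
    finally show ?thesis by (simp add: add.assoc)
  qed
  \<comment> \<open>The level sets consist of nonzero residues, so z = 0 is estimated by the trivial
    bound t.\<close>
  have zero: "c 0 ^ 3 \<le> ?t * ?q\<^sup>2 * (1 + ln ?t + ln ?q)"
  proof -
    have "c 0 ^ 3 \<le> ?t ^ 3" using conv_le_t by (intro power_mono) (auto simp: c_def)
    also have "\<dots> = ?t * ?t\<^sup>2" by (simp add: power3_eq_cube power2_eq_square)
    also have "\<dots> \<le> ?t * ?q\<^sup>2 * 1" using q t by (simp add: mult_left_mono power_mono)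
    also have "\<dots> \<le> ?t * ?q\<^sup>2 * (1 + ln ?t + ln ?q)" using lnq t by (intro mult_left_mono) auto
    finally show ?thesis .
  qed
  have "{0..<int p} = insert 0 ?R" using prime_gt_0_nat[OF prime_p] by auto
  then have "(\<Sum>z\<in>{0..<int p}. c z ^ 3) = c 0 ^ 3 + (\<Sum>z\<in>?R. c z ^ 3)" by simp
  also have "(\<Sum>z\<in>?R. c z ^ 3) = (\<Sum>z\<in>H. c z ^ 3) + (\<Sum>z\<in>L. c z ^ 3)"
  proof -
    have "?R = H \<union> L" "H \<inter> L = {}" by (auto simp: H_def L_def)
    then show ?thesis by (metis finite_Un finite_atLeastLessThan_int sum.union_disjoint)
  qed
  finally have "(\<Sum>z\<in>{0..<int p}. c z ^ 3)
    \<le> 32769 * (?t * ?q\<^sup>2 * (1 + ln ?t + ln ?q)) + 131072 * (?q ^ 3 / ?t + ?q ^ 3 * ?t ^ 3 / ?p\<^sup>2)"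
    using zero high low T2 by linarith
  moreover have "?t * ?q\<^sup>2 * (1 + ln ?t + ln ?q) \<ge> 0" using lnq t by simp
  ultimately show ?thesis unfolding c_def by (simp add: algebra_simps)
qed

text \<open>\<open>R\<close> is the dilate of \<open>Q\<close> by the inverse of a, written as a
  preimage so that no inverse has to be chosen.\<close>

lemma scaled_preimage:
  assumes Q: "invariant Q" and a: "a \<in> {1..<int p}"
  defines "R \<equiv> {r \<in> {1..<int p}. a * r mod int p \<in> Q}"
  shows "invariant R" "card R = card Q"
    "\<And>y. a * y mod int p \<in> Q \<longleftrightarrow> y mod int p \<in> R"
proof -
  have p0: "int p > 0" using prime_gt_0_nat[OF prime_p] by simp
  show iff: "a * y mod int p \<in> Q \<longleftrightarrow> y mod int p \<in> R" for y
  proof -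
    have e: "a * (y mod int p) mod int p = a * y mod int p" by (simp add: mod_mult_right_eq)
    have "y mod int p \<noteq> 0" if "a * y mod int p \<in> Q"
    proof
      assume "y mod int p = 0"
      then have "a * y mod int p = 0" using e by simp
      then show False using that invariantD(3)[OF Q] by simp
    qed
    then have "y mod int p \<in> {1..<int p}" if "a * y mod int p \<in> Q"
      using that p0 pos_mod_sign[OF p0, of y] pos_mod_bound[OF p0, of y] by fastforce
    then show ?thesis unfolding R_def using e by auto
  qed
  show "invariant R"
    unfolding invariant_def
  proof (intro conjI ballI)
    fix x r assume x: "x \<in> G" and r: "r \<in> R"
    have "a * (x * r) mod int p = x * (a * r mod int p) mod int p"
      by (simp add: mod_mult_right_eq mult.left_commute)
    then have "a * (x * r) mod int p \<in> Q" using invariantD(4)[OF Q x] r by (simp add: R_def)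
    then show "x * r mod int p \<in> R" using iff by blast
  qed (auto simp: R_def)
  have "bij_betw (\<lambda>x. a * x mod int p) R Q"
    unfolding bij_betw_def
  proof
    show "inj_on (\<lambda>x. a * x mod int p) R"
      by (rule inj_on_subset[OF inj_on_mult_mod[OF not_dvd_residue[OF a]]]) (auto simp: R_def)
    show "(\<lambda>x. a * x mod int p) ` R = Q"
    proof
      show "(\<lambda>x. a * x mod int p) ` R \<subseteq> Q" by (auto simp: R_def)
      show "Q \<subseteq> (\<lambda>x. a * x mod int p) ` R"
      proof
        fix q assume q: "q \<in> Q"
        then have "q \<in> {0..<int p}" using invariantD(2)[OF Q] by auto
        then obtain r where r: "r \<in> {0..<int p}" "q = a * r mod int p"
          using bij_betw_mult_mod[OF not_dvd_residue[OF a]] unfolding bij_betw_def by blast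
        then have "r mod int p \<in> R" using iff q by blast
        then show "q \<in> (\<lambda>x. a * x mod int p) ` R" using r by auto
      qed
    qed
  qed
  then show "card R = card Q" by (rule bij_betw_same_card)
qed

text \<open>Averaging the substitution of xq for q over x in \<open>G\<close> writes the
  autocorrelation as a sum of correlations of \<open>Q\<close> with the cosets qG.\<close>

lemma t_mult_autocorr:
  assumes Q: "invariant Q"
  shows "t * autocorr Q z = (\<Sum>q\<in>Q. card {x \<in> G. (q * x + z) mod int p \<in> Q})"
proof -
  have fin: "finite Q" by (rule invariantD(1)[OF Q])
  have "(\<Sum>q\<in>Q. card {x \<in> G. (q * x + z) mod int p \<in> Q})
      = (\<Sum>q\<in>Q. \<Sum>x\<in>G. if (q * x + z) mod int p \<in> Q then 1 else 0)"
    using finite_G by (simp add: sum.If_cases Int_def)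
  also have "\<dots> = (\<Sum>x\<in>G. \<Sum>q\<in>Q. if (q * x + z) mod int p \<in> Q then 1 else 0)" by (rule sum.swap)
  also have "\<dots> = (\<Sum>x\<in>G. autocorr Q z)"
  proof (rule sum.cong[OF refl])
    fix x assume x: "x \<in> G"
    have "(\<Sum>q\<in>Q. if (q * x + z) mod int p \<in> Q then 1 else (0::nat))
        = (\<Sum>q\<in>Q. if (x * q mod int p + z) mod int p \<in> Q then 1 else 0)"
      by (simp add: mod_add_left_eq mult.commute)
    also have "\<dots> = (\<Sum>q\<in>Q. if (q + z) mod int p \<in> Q then 1 else 0)"
      by (rule sum.reindex_bij_betw[OF bij_betw_invariant[OF Q x]])
    also have "\<dots> = autocorr Q z"
      unfolding autocorr_def using fin by (simp add: sum.If_cases Int_def)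
    finally show "(\<Sum>q\<in>Q. if (q * x + z) mod int p \<in> Q then 1 else 0) = autocorr Q z" .
  qed
  finally show ?thesis by simp
qed

text \<open>Substituting qz for z turns the correlation of qG with \<open>Q\<close> into that of
  \<open>G\<close> with a dilate of \<open>Q\<close>, to which \<open>sum_conv_cubed\<close>
  applies. The power mean inequality over q in \<open>Q\<close> combines these bounds.\<close>

lemma sum_autocorr_cubed:
  assumes Q: "invariant Q" "Q \<noteq> {}" and tp: "t ^ 3 \<le> p\<^sup>2"
  shows "real t ^ 3 * (\<Sum>z\<in>{0..<int p}. real (autocorr Q z) ^ 3)
     \<le> real (card Q) ^ 3 * (131072 * (real t * real (card Q) ^ 2 * (1 + ln (real t) + ln (real (card Q)))
          + real (card Q) ^ 3 / real t + real (card Q) ^ 3 * real t ^ 3 / real p ^ 2))"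
    (is "_ \<le> _ * ?B")
proof -
  let ?R = "{0..<int p}"
  define d where "d q z = real (card {x \<in> G. (q * x + z) mod int p \<in> Q})" for q z
  have one: "(\<Sum>z\<in>?R. d q z ^ 3) \<le> ?B" if q: "q \<in> Q" for q
  proof -
    have qp: "q \<in> {1..<int p}" using q invariantD(2)[OF Q(1)] by auto
    define R where "R = {r \<in> {1..<int p}. q * r mod int p \<in> Q}"
    note R = scaled_preimage[OF Q(1) qp, folded R_def]
    have "(\<Sum>z\<in>?R. d q z ^ 3) = (\<Sum>z\<in>?R. d q (q * z mod int p) ^ 3)"
      by (rule sum.reindex_bij_betw[OF bij_betw_mult_mod[OF not_dvd_residue[OF qp]], symmetric])
    also have "\<dots> = (\<Sum>z\<in>?R. real (conv R z) ^ 3)"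
    proof (rule sum.cong[OF refl])
      fix z
      have "(q * x + q * z mod int p) mod int p \<in> Q \<longleftrightarrow> (x + z) mod int p \<in> R" for x
        using R(3)[of "x + z"] by (simp add: mod_simps distrib_left)
      then show "d q (q * z mod int p) ^ 3 = real (conv R z) ^ 3" by (simp add: d_def conv_def)
    qed
    also have "\<dots> \<le> ?B"
    proof -
      have "R \<noteq> {}" using R(2) Q invariantD(1)[OF Q(1)] by (metis card_0_eq card.empty)
      then show ?thesis using sum_conv_cubed[OF R(1) _ tp] unfolding R(2) by blast
    qed
    finally show ?thesis .
  qed
  have "real t ^ 3 * (\<Sum>z\<in>?R. real (autocorr Q z) ^ 3) = (\<Sum>z\<in>?R. (\<Sum>q\<in>Q. d q z) ^ 3)"
    unfolding sum_distrib_left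
  proof (rule sum.cong[OF refl])
    fix z
    have "real (t * autocorr Q z) = (\<Sum>q\<in>Q. d q z)"
      unfolding t_mult_autocorr[OF Q(1)] by (simp add: d_def)
    then show "real t ^ 3 * real (autocorr Q z) ^ 3 = (\<Sum>q\<in>Q. d q z) ^ 3"
      by (simp flip: power_mult_distrib)
  qed
  also have "\<dots> \<le> (\<Sum>z\<in>?R. real (card Q) ^ 2 * (\<Sum>q\<in>Q. d q z ^ 3))"
    by (intro sum_mono sum_cubed_le) (simp add: d_def)
  also have "\<dots> = real (card Q) ^ 2 * (\<Sum>q\<in>Q. \<Sum>z\<in>?R. d q z ^ 3)"
    unfolding sum_distrib_left[symmetric] by (subst sum.swap) (rule refl)
  also have "\<dots> \<le> real (card Q) ^ 2 * (\<Sum>q\<in>Q. ?B)"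
    using one by (intro mult_left_mono sum_mono) auto
  also have "\<dots> = real (card Q) ^ 3 * ?B" by (simp add: power2_eq_square power3_eq_cube)
  finally show ?thesis .
qed

section \<open>Exponential sums and the trace inequality\<close>

definition chr :: "int \<Rightarrow> complex" where
  "chr x = exp (2 * complex_of_real pi * \<i> * of_int x / of_nat p)"

definition expsum :: "int set \<Rightarrow> int \<Rightarrow> complex" where
  "expsum Q x = (\<Sum>u\<in>Q. chr (u * x))"

definition E3 :: "int set \<Rightarrow> real" where
  "E3 Q = (\<Sum>z\<in>{0..<int p}. real (autocorr Q z) ^ 3)"

lemma p_gt_0: "int p > 0"
  using prime_gt_0_nat[OF prime_p] by simp

lemma chr_add: "chr (x + y) = chr x * chr y"
  by (simp add: chr_def exp_add[symmetric] add_divide_distrib distrib_left)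

lemma cnj_chr: "cnj (chr x) = chr (- x)"
  by (simp add: chr_def exp_cnj)

lemma chr_diff: "chr (x - y) = chr x * cnj (chr y)"
  using chr_add[of x "- y"] by (simp add: cnj_chr)

lemma chr_eq_1_iff: "chr x = 1 \<longleftrightarrow> int p dvd x"
proof
  assume "int p dvd x"
  then obtain k where "x = int p * k" by (auto elim: dvdE)
  then have "2 * complex_of_real pi * \<i> * of_int x / of_nat p = of_int k * (of_real pi * (\<i> * 2))"
    using p_gt_0 by (simp add: field_simps)
  then show "chr x = 1" unfolding chr_def exp_eq_1 using p_gt_0 by auto
next
  assume "chr x = 1"
  then obtain n :: int where "2 * pi * real_of_int x / real p = of_int (2 * n) * pi"
    unfolding chr_def exp_eq_1 by auto
  then have "real_of_int x = of_int (int p * n)" using p_gt_0 by (simp add: field_simps)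
  then have "x = int p * n" using of_int_eq_iff by blast
  then show "int p dvd x" by simp
qed

lemma chr_cong:
  assumes "[x = y] (mod int p)"
  shows "chr x = chr y"
proof -
  have "chr x = chr (x - y) * chr y" by (simp flip: chr_add)
  moreover have "chr (x - y) = 1" using assms by (simp add: chr_eq_1_iff cong_iff_dvd_diff)
  ultimately show ?thesis by simp
qed

lemma expsum_cong:
  assumes "[x = y] (mod int p)"
  shows "expsum Q x = expsum Q y"
  unfolding expsum_def by (intro sum.cong refl chr_cong cong_mult assms cong_refl)

lemma cnj_expsum: "cnj (expsum Q x) = expsum Q (- x)"
  by (simp add: expsum_def cnj_chr)

lemma expsum_mult_G:
  assumes "invariant Q" "y \<in> G"
  shows "expsum Q (y * x) = expsum Q x"
proof -
  have "expsum Q x = (\<Sum>u\<in>Q. chr ((y * u mod int p) * x))"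
    unfolding expsum_def
    by (rule sum.reindex_bij_betw[OF bij_betw_invariant[OF assms], symmetric])
  also have "\<dots> = (\<Sum>u\<in>Q. chr (u * (y * x)))"
  proof (intro sum.cong refl chr_cong)
    fix u
    have "[(y * u mod int p) * x = (y * u) * x] (mod int p)" by (intro cong_mult cong_refl) (simp add: cong_def)
    then show "[(y * u mod int p) * x = u * (y * x)] (mod int p)" by (simp add: mult_ac)
  qed
  finally show ?thesis by (simp add: expsum_def)
qed

lemma sum_chr: "(\<Sum>a\<in>{0..<int p}. chr (x * a)) = (if int p dvd x then of_nat p else 0)"
proof (cases "int p dvd x")
  case True
  then have "chr (x * a) = 1" for a by (simp add: chr_eq_1_iff)
  then show ?thesis using True by simp
next
  case False
  let ?S = "\<Sum>a\<in>{0..<int p}. chr (x * a)"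
  have "?S = (\<Sum>a\<in>{0..<int p}. chr (x * ((a + 1) mod int p)))"
    by (rule sum.reindex_bij_betw[OF bij_betw_add_mod, symmetric])
  also have "\<dots> = (\<Sum>a\<in>{0..<int p}. chr (x * a) * chr x)"
  proof (intro sum.cong refl)
    fix a
    have "chr (x * ((a + 1) mod int p)) = chr (x * a + x)"
      by (rule chr_cong) (simp add: cong_def mod_mult_right_eq distrib_left)
    then show "chr (x * ((a + 1) mod int p)) = chr (x * a) * chr x" by (simp add: chr_add)
  qed
  also have "\<dots> = ?S * chr x" by (simp add: sum_distrib_right)
  finally have "?S * (chr x - 1) = 0" by (simp add: algebra_simps)
  then show ?thesis using False chr_eq_1_iff by simp
qed

lemma parseval:
  fixes u v :: "int \<Rightarrow> complex"
  shows "(\<Sum>a\<in>{0..<int p}. (\<Sum>z\<in>{0..<int p}. u z * chr (z * a)) * cnj (\<Sum>w\<in>{0..<int p}. v w * chr (w * a)))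
     = of_nat p * (\<Sum>z\<in>{0..<int p}. u z * cnj (v z))"
proof -
  let ?R = "{0..<int p}"
  have "(\<Sum>a\<in>?R. (\<Sum>z\<in>?R. u z * chr (z * a)) * cnj (\<Sum>w\<in>?R. v w * chr (w * a)))
    = (\<Sum>a\<in>?R. \<Sum>z\<in>?R. \<Sum>w\<in>?R. u z * cnj (v w) * chr ((z - w) * a))"
    unfolding cnj_sum sum_product
    by (intro sum.cong refl) (simp add: left_diff_distrib chr_diff)
  also have "\<dots> = (\<Sum>z\<in>?R. \<Sum>w\<in>?R. \<Sum>a\<in>?R. u z * cnj (v w) * chr ((z - w) * a))"
    by (rule trans[OF sum.swap sum.cong[OF refl sum.swap]])
  also have "\<dots> = (\<Sum>z\<in>?R. \<Sum>w\<in>?R. if z = w then u z * cnj (v w) * of_nat p else 0)"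
  proof (intro sum.cong refl)
    fix z w assume zw: "z \<in> ?R" "w \<in> ?R"
    have "int p dvd z - w \<longleftrightarrow> z = w"
    proof
      assume "int p dvd z - w"
      then have "z mod int p = w mod int p" unfolding mod_eq_dvd_iff .
      moreover have "z mod int p = z" "w mod int p = w" using zw by auto
      ultimately show "z = w" by metis
    qed simp
    then show "(\<Sum>a\<in>?R. u z * cnj (v w) * chr ((z - w) * a)) = (if z = w then u z * cnj (v w) * of_nat p else 0)"
      by (simp add: sum_chr flip: sum_distrib_left)
  qed
  also have "\<dots> = of_nat p * (\<Sum>z\<in>?R. u z * cnj (v z))"
    by (simp add: sum_distrib_left mult.commute)
  finally show ?thesis .
qed

section \<open>Moments of exponential sums through autocorrelations\<close>

lemma sum_subset_shift:
  fixes f :: "int \<Rightarrow> 'b::comm_monoid_add"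
  assumes Q: "Q \<subseteq> {0..<int p}" and per: "\<And>a b. [a = b] (mod int p) \<Longrightarrow> f a = f b"
  shows "(\<Sum>y\<in>Q. f (y - x)) = (\<Sum>z\<in>{0..<int p}. if (x + z) mod int p \<in> Q then f z else 0)"
proof -
  let ?R = "{0..<int p}"
  have "(\<Sum>y\<in>Q. f (y - x)) = (\<Sum>y\<in>?R. if y \<in> Q then f (y - x) else 0)"
    using Q by (simp add: sum.If_cases Int_absorb1 Int_absorb2 Int_commute)
  also have "\<dots> = (\<Sum>z\<in>?R. if (z + x) mod int p \<in> Q then f ((z + x) mod int p - x) else 0)"
    by (rule sum.reindex_bij_betw[OF bij_betw_add_mod, symmetric])
  also have "\<dots> = (\<Sum>z\<in>?R. if (x + z) mod int p \<in> Q then f z else 0)"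
  proof (intro sum.cong refl)
    fix z
    have "f ((z + x) mod int p - x) = f z"
      by (rule per) (simp add: cong_def mod_diff_left_eq)
    then show "(if (z + x) mod int p \<in> Q then f ((z + x) mod int p - x) else 0)
       = (if (x + z) mod int p \<in> Q then f z else 0)" by (simp add: add.commute)
  qed
  finally show ?thesis .
qed

lemma sum_differences:
  fixes f :: "int \<Rightarrow> 'b::comm_semiring_1"
  assumes Q: "Q \<subseteq> {0..<int p}" and per: "\<And>a b. [a = b] (mod int p) \<Longrightarrow> f a = f b"
  shows "(\<Sum>x\<in>Q. \<Sum>y\<in>Q. f (y - x)) = (\<Sum>z\<in>{0..<int p}. of_nat (autocorr Q z) * f z)"
proof -
  have fin: "finite Q" using Q finite_subset by blast
  have "(\<Sum>x\<in>Q. \<Sum>y\<in>Q. f (y - x))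
      = (\<Sum>x\<in>Q. \<Sum>z\<in>{0..<int p}. if (x + z) mod int p \<in> Q then f z else 0)"
    by (intro sum.cong refl sum_subset_shift[OF Q per])
  also have "\<dots> = (\<Sum>z\<in>{0..<int p}. \<Sum>x\<in>Q. if (x + z) mod int p \<in> Q then f z else 0)"
    by (rule sum.swap)
  also have "\<dots> = (\<Sum>z\<in>{0..<int p}. of_nat (autocorr Q z) * f z)"
    unfolding autocorr_def using fin by (intro sum.cong refl) (simp add: sum.If_cases Int_def)
  finally show ?thesis .
qed

lemma autocorr_cong: "[a = b] (mod int p) \<Longrightarrow> autocorr Q a = autocorr Q b"
  unfolding autocorr_def by (metis cong_def mod_add_right_eq)

lemma norm_expsum_sq:
  assumes "Q \<subseteq> {0..<int p}"
  shows "complex_of_real ((cmod (expsum Q a))\<^sup>2)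
     = (\<Sum>z\<in>{0..<int p}. of_nat (autocorr Q z) * chr (z * a))"
proof -
  have "complex_of_real ((cmod (expsum Q a))\<^sup>2) = cnj (expsum Q a) * expsum Q a"
    by (metis complex_norm_square mult.commute of_real_power)
  also have "\<dots> = (\<Sum>x\<in>Q. \<Sum>y\<in>Q. chr ((y - x) * a))"
    unfolding expsum_def cnj_sum sum_product
    by (intro sum.cong refl) (simp only: left_diff_distrib chr_diff, rule mult.commute)
  also have "\<dots> = (\<Sum>z\<in>{0..<int p}. of_nat (autocorr Q z) * chr (z * a))"
    by (rule sum_differences[OF assms, of "\<lambda>z. chr (z * a)"]) (intro chr_cong cong_mult cong_refl)
  finally show ?thesis .
qed

text \<open>A real number is its own conjugate; this form fits the second factor in
  \<open>parseval\<close>.\<close>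

lemma norm_expsum_sq_cnj:
  assumes "Q \<subseteq> {0..<int p}"
  shows "complex_of_real ((cmod (expsum Q a))\<^sup>2)
     = cnj (\<Sum>z\<in>{0..<int p}. of_nat (autocorr Q z) * chr (z * a))"
  using norm_expsum_sq[OF assms, of a] by (metis complex_cnj_complex_of_real)

lemma sum_norm_expsum_fourth:
  assumes "Q \<subseteq> {0..<int p}"
  shows "(\<Sum>a\<in>{0..<int p}. cmod (expsum Q a) ^ 4)
      = real p * (\<Sum>z\<in>{0..<int p}. real (autocorr Q z) ^ 2)"
proof -
  have "complex_of_real (\<Sum>a\<in>{0..<int p}. cmod (expsum Q a) ^ 4)
     = (\<Sum>a\<in>{0..<int p}. complex_of_real ((cmod (expsum Q a))\<^sup>2) * complex_of_real ((cmod (expsum Q a))\<^sup>2))"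
    by (simp flip: power_add of_real_mult)
  also have "\<dots> = (\<Sum>a\<in>{0..<int p}. (\<Sum>z\<in>{0..<int p}. of_nat (autocorr Q z) * chr (z * a))
        * cnj (\<Sum>z\<in>{0..<int p}. of_nat (autocorr Q z) * chr (z * a)))"
    by (intro sum.cong refl arg_cong2[of _ _ _ _ "(*)"] norm_expsum_sq[OF assms] norm_expsum_sq_cnj[OF assms])
  also have "\<dots> = complex_of_real (real p * (\<Sum>z\<in>{0..<int p}. real (autocorr Q z) ^ 2))"
    unfolding parseval by (simp add: power2_eq_square)
  finally show ?thesis unfolding of_real_eq_iff .
qed

text \<open>The squared moduli are the Fourier transform of the autocorrelation k. Parseval in b
  gives p times the transform of k^2, and Parseval in a, against the transform of k, gives p^2 times
  the sum of k^3.\<close>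

lemma sum_norm_expsum_triple:
  assumes Q: "Q \<subseteq> {0..<int p}"
  shows "(\<Sum>a\<in>{0..<int p}. \<Sum>b\<in>{0..<int p}.
       (cmod (expsum Q a))\<^sup>2 * (cmod (expsum Q b))\<^sup>2 * (cmod (expsum Q (b - a)))\<^sup>2)
      = real p ^ 2 * E3 Q"
proof -
  let ?R = "{0..<int p}"
  define A where "A a = complex_of_real ((cmod (expsum Q a))\<^sup>2)" for a
  define k where "k z = complex_of_real (real (autocorr Q z))" for z
  have A1: "A a = (\<Sum>z\<in>?R. k z * chr (z * a))" for a
    using norm_expsum_sq[OF Q] by (simp add: A_def k_def)
  have A2: "A a = cnj (\<Sum>z\<in>?R. k z * chr (z * a))" for a
    using norm_expsum_sq_cnj[OF Q] by (simp add: A_def k_def)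
  have inner: "(\<Sum>b\<in>?R. A b * A (b - a)) = of_nat p * (\<Sum>z\<in>?R. (k z)\<^sup>2 * chr (z * a))" for a
  proof -
    have "A (b - a) = cnj (\<Sum>z\<in>?R. (k z * chr (- (z * a))) * chr (z * b))" for b
      unfolding A2[of "b - a"]
      by (simp add: right_diff_distrib chr_diff cnj_chr mult_ac)
    then have "(\<Sum>b\<in>?R. A b * A (b - a))
        = (\<Sum>b\<in>?R. (\<Sum>z\<in>?R. k z * chr (z * b)) * cnj (\<Sum>z\<in>?R. (k z * chr (- (z * a))) * chr (z * b)))"
      using A1 by (intro sum.cong refl arg_cong2[of _ _ _ _ "(*)"]) auto
    also have "\<dots> = of_nat p * (\<Sum>z\<in>?R. k z * cnj (k z * chr (- (z * a))))" by (rule parseval)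
    also have "\<dots> = of_nat p * (\<Sum>z\<in>?R. (k z)\<^sup>2 * chr (z * a))"
      by (simp add: cnj_chr k_def power2_eq_square mult.assoc)
    finally show ?thesis .
  qed
  have "complex_of_real (\<Sum>a\<in>?R. \<Sum>b\<in>?R.
       (cmod (expsum Q a))\<^sup>2 * (cmod (expsum Q b))\<^sup>2 * (cmod (expsum Q (b - a)))\<^sup>2)
     = (\<Sum>a\<in>?R. (\<Sum>b\<in>?R. A b * A (b - a)) * A a)"
    by (simp add: A_def sum_distrib_left sum_distrib_right mult_ac)
  also have "\<dots> = (\<Sum>a\<in>?R. of_nat p * ((\<Sum>z\<in>?R. (k z)\<^sup>2 * chr (z * a)) * cnj (\<Sum>z\<in>?R. k z * chr (z * a))))"
    unfolding inner by (intro sum.cong refl) (simp only: A2 mult.assoc)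
  also have "\<dots> = of_nat p * (of_nat p * (\<Sum>z\<in>?R. (k z)\<^sup>2 * cnj (k z)))"
    unfolding sum_distrib_left[symmetric] parseval ..
  also have "\<dots> = complex_of_real (real p ^ 2 * E3 Q)"
    by (simp add: k_def E3_def power2_eq_square power3_eq_cube mult.assoc)
  finally show ?thesis unfolding of_real_eq_iff .
qed

text \<open>Expanding the square gives pairs x, y in \<open>G\<close>. For a fixed pair, the sums
  over a and over b each count the autocorrelation at y - x, and summing over the pairs adds the
  third factor.\<close>

lemma sum_triple_corr:
  "(\<Sum>a\<in>{0..<int p}. \<Sum>b\<in>{0..<int p}.
      (real (card {x \<in> G. (x + a) mod int p \<in> G \<and> (x + b) mod int p \<in> G}))\<^sup>2) = E3 G"
proof -
  let ?R = "{0..<int p}"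
  define I where "I z = (if z mod int p \<in> G then 1 else 0 :: real)" for z
  have GR: "G \<subseteq> ?R" using G_subset by auto
  have cC: "real (card {x \<in> G. (x + a) mod int p \<in> G \<and> (x + b) mod int p \<in> G})
      = (\<Sum>x\<in>G. I (x + a) * I (x + b))" for a b
  proof -
    have "I (x + a) * I (x + b) = (if (x + a) mod int p \<in> G \<and> (x + b) mod int p \<in> G then 1 else 0)" for x
      by (simp add: I_def)
    then show ?thesis using finite_G by (simp add: sum.If_cases Int_def)
  qed
  have sh: "(\<Sum>a\<in>?R. I (x + a) * I (y + a)) = real (autocorr G (y - x))" for x y
  proof -
    have "(\<Sum>a\<in>?R. I (x + a) * I (y + a)) = (\<Sum>a\<in>?R. if (x + a) mod int p \<in> G then I (y + a) else 0)"
      by (intro sum.cong refl) (simp add: I_def)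
    also have "\<dots> = (\<Sum>u\<in>G. I (y + (u - x)))"
    proof (rule sum_subset_shift[OF GR, of "\<lambda>a. I (y + a)", symmetric])
      fix a b assume "[a = b] (mod int p)"
      then have "(y + a) mod int p = (y + b) mod int p"
        using cong_add[OF cong_refl, of a b "int p" y] by (simp add: cong_def)
      then show "I (y + a) = I (y + b)" by (simp add: I_def)
    qed
    also have "\<dots> = (\<Sum>u\<in>G. if (u + (y - x)) mod int p \<in> G then 1 else 0)"
      by (simp add: I_def algebra_simps)
    also have "\<dots> = real (autocorr G (y - x))"
      unfolding autocorr_def using finite_G by (simp add: sum.If_cases Int_def)
    finally show ?thesis .
  qed
  have "(\<Sum>a\<in>?R. \<Sum>b\<in>?R. (\<Sum>x\<in>G. I (x + a) * I (x + b))\<^sup>2)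
      = (\<Sum>a\<in>?R. \<Sum>b\<in>?R. \<Sum>x\<in>G. \<Sum>y\<in>G. (I (x + a) * I (y + a)) * (I (x + b) * I (y + b)))"
    unfolding power2_eq_square sum_product by (simp only: mult_ac)
  also have "\<dots> = (\<Sum>a\<in>?R. \<Sum>x\<in>G. \<Sum>b\<in>?R. \<Sum>y\<in>G. (I (x + a) * I (y + a)) * (I (x + b) * I (y + b)))"
    by (rule sum.cong[OF refl sum.swap])
  also have "\<dots> = (\<Sum>x\<in>G. \<Sum>a\<in>?R. \<Sum>y\<in>G. \<Sum>b\<in>?R. (I (x + a) * I (y + a)) * (I (x + b) * I (y + b)))"
    by (subst sum.swap) (intro sum.cong refl sum.swap)
  also have "\<dots> = (\<Sum>x\<in>G. \<Sum>y\<in>G. \<Sum>a\<in>?R. \<Sum>b\<in>?R. (I (x + a) * I (y + a)) * (I (x + b) * I (y + b)))"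
    by (intro sum.cong refl sum.swap)
  also have "\<dots> = (\<Sum>x\<in>G. \<Sum>y\<in>G. (real (autocorr G (y - x)))\<^sup>2)"
    by (intro sum.cong refl) (simp add: sh power2_eq_square flip: sum_product)
  also have "\<dots> = (\<Sum>z\<in>?R. real (autocorr G z) * (real (autocorr G z))\<^sup>2)"
    by (rule sum_differences[OF GR, of "\<lambda>z. (real (autocorr G z))\<^sup>2"])
      (auto dest: autocorr_cong[of _ _ G])
  finally show ?thesis unfolding cC E3_def by (simp add: power3_eq_cube power2_eq_square mult.assoc)
qed

text \<open>Let \<open>V\<close> be the matrix \<open>(chr (x u))\<close> with rows indexed by \<open>G\<close> and columns by \<open>Q\<close>. Then
  \<open>VV\<^sup>* = (expsum Q (x - y))\<close> has the constant vector as an eigenvector with eigenvalue \<open>mean_sq Q\<close>,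
  \<open>trace_kernel\<close> is \<open>VV\<^sup>*V\<close>, and its squared Frobenius norm \<open>trace_cubed\<close> is the trace of
  \<open>(VV\<^sup>*)\<^sup>3\<close>.\<close>

definition mean_sq :: "int set \<Rightarrow> real" where
  "mean_sq Q = (\<Sum>u\<in>Q. (cmod (expsum G u))\<^sup>2) / real t"

definition trace_kernel :: "int set \<Rightarrow> int \<Rightarrow> int \<Rightarrow> complex" where
  "trace_kernel Q x u = (\<Sum>y\<in>G. expsum Q (x - y) * chr (y * u))"

definition trace_cubed :: "int set \<Rightarrow> real" where
  "trace_cubed Q = (\<Sum>x\<in>G. \<Sum>u\<in>Q. (cmod (trace_kernel Q x u))\<^sup>2)"

text \<open>Since u can be replaced by yu, the left side does not depend on y in \<open>G\<close>;
  its average over y is \<open>mean_sq Q\<close>.\<close>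

lemma eigenvalue_mean_sq:
  assumes Q: "invariant Q" and y: "y \<in> G"
  shows "(\<Sum>u\<in>Q. chr (y * u) * cnj (expsum G u)) = of_real (mean_sq Q)"
proof -
  define h where "h = (\<Sum>u\<in>Q. chr u * cnj (expsum G u))"
  have h: "(\<Sum>u\<in>Q. chr (y * u) * cnj (expsum G u)) = h" if y: "y \<in> G" for y
  proof -
    have "h = (\<Sum>u\<in>Q. chr (y * u mod int p) * cnj (expsum G (y * u mod int p)))"
      unfolding h_def by (rule sum.reindex_bij_betw[OF bij_betw_invariant[OF Q y], symmetric])
    also have "\<dots> = (\<Sum>u\<in>Q. chr (y * u) * cnj (expsum G u))"
    proof (intro sum.cong refl)
      fix u
      have c: "[y * u mod int p = y * u] (mod int p)" by (simp add: cong_def)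
      show "chr (y * u mod int p) * cnj (expsum G (y * u mod int p)) = chr (y * u) * cnj (expsum G u)"
        unfolding chr_cong[OF c] expsum_cong[OF c] expsum_mult_G[OF invariant_G y] ..
    qed
    finally show ?thesis by simp
  qed
  have "of_nat t * h = (\<Sum>y\<in>G. \<Sum>u\<in>Q. chr (y * u) * cnj (expsum G u))"
    using h by simp
  also have "\<dots> = (\<Sum>u\<in>Q. expsum G u * cnj (expsum G u))"
    unfolding sum.swap[of _ Q G] by (simp add: expsum_def sum_distrib_right)
  also have "\<dots> = of_real (\<Sum>u\<in>Q. (cmod (expsum G u))\<^sup>2)"
    by (simp add: complex_norm_square del: of_real_power)
  finally have "h = of_real (mean_sq Q)"
    using t_pos by (simp add: mean_sq_def field_simps)
  then show ?thesis using h[OF y] by simp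
qed

lemma sum_expsum_differences:
  assumes Q: "invariant Q" and x: "x \<in> G"
  shows "(\<Sum>y\<in>G. expsum Q (x - y)) = of_real (mean_sq Q)"
proof -
  have "(\<Sum>y\<in>G. expsum Q (x - y)) = (\<Sum>u\<in>Q. \<Sum>y\<in>G. chr (x * u) * cnj (chr (y * u)))"
    unfolding expsum_def sum.swap[of _ Q G]
    by (intro sum.cong refl) (simp only: right_diff_distrib chr_diff mult.commute)
  also have "\<dots> = (\<Sum>u\<in>Q. chr (x * u) * cnj (expsum G u))"
    by (simp add: expsum_def sum_distrib_left)
  finally show ?thesis using eigenvalue_mean_sq[OF Q x] by simp
qed

text \<open>Cauchy-Schwarz replaces the spectral theorem. With m the eigenvalue, pairing
  \<open>trace_kernel\<close> with the conjugates of \<open>expsum G u\<close> gives t m^2, while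
  the latter have squared norm t^2 m on G \<times> Q. Hence t^2 m^4 is at most t^2 m times the
  trace.\<close>

lemma mean_sq_cubed_le_trace:
  assumes Q: "invariant Q"
  shows "mean_sq Q ^ 3 \<le> trace_cubed Q"
proof -
  let ?m = "mean_sq Q" and ?t = "real t"
  have m0: "?m \<ge> 0" by (simp add: mean_sq_def sum_nonneg)
  have tr0: "trace_cubed Q \<ge> 0" by (simp add: trace_cubed_def sum_nonneg)
  have t: "?t > 0" using t_pos by simp
  have "(\<Sum>(x, u)\<in>G \<times> Q. trace_kernel Q x u * cnj (expsum G u))
      = (\<Sum>x\<in>G. \<Sum>u\<in>Q. \<Sum>y\<in>G. expsum Q (x - y) * (chr (y * u) * cnj (expsum G u)))"
    by (simp add: trace_kernel_def sum.cartesian_product[symmetric] sum_distrib_right mult.assoc)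
  also have "\<dots> = (\<Sum>x\<in>G. \<Sum>y\<in>G. expsum Q (x - y) * (\<Sum>u\<in>Q. chr (y * u) * cnj (expsum G u)))"
    unfolding sum_distrib_left by (intro sum.cong refl sum.swap)
  also have "\<dots> = (\<Sum>x\<in>G. \<Sum>y\<in>G. expsum Q (x - y) * of_real ?m)"
    using eigenvalue_mean_sq[OF Q] by (intro sum.cong refl) simp
  also have "\<dots> = (\<Sum>x\<in>G. of_real ?m * of_real ?m)"
    using sum_expsum_differences[OF Q] by (intro sum.cong refl) (simp flip: sum_distrib_right)
  also have "\<dots> = of_real (?t * ?m\<^sup>2)" by (simp add: power2_eq_square)
  finally have eq: "(\<Sum>(x, u)\<in>G \<times> Q. trace_kernel Q x u * cnj (expsum G u)) = of_real (?t * ?m\<^sup>2)" .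
  have "(?t * ?m\<^sup>2)\<^sup>2 = (cmod (\<Sum>(x, u)\<in>G \<times> Q. trace_kernel Q x u * cnj (expsum G u)))\<^sup>2"
    unfolding eq norm_of_real by simp
  also have "\<dots> \<le> (\<Sum>(x, u)\<in>G \<times> Q. (cmod (trace_kernel Q x u))\<^sup>2) * (\<Sum>(x, u)\<in>G \<times> Q. (cmod (expsum G u))\<^sup>2)"
    using cauchy_schwarz_complex[of "\<lambda>(x, u). trace_kernel Q x u" "\<lambda>(x, u). cnj (expsum G u)" "G \<times> Q"]
    by (simp add: case_prod_unfold)
  also have "(\<Sum>(x, u)\<in>G \<times> Q. (cmod (trace_kernel Q x u))\<^sup>2) = trace_cubed Q"
    by (simp add: trace_cubed_def sum.cartesian_product)
  also have "(\<Sum>(x, u)\<in>G \<times> Q. (cmod (expsum G u))\<^sup>2) = ?t * (?t * ?m)"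
    using t by (simp add: mean_sq_def sum.cartesian_product[symmetric])
  finally have "?t\<^sup>2 * (?m * ?m ^ 3) \<le> ?t\<^sup>2 * (?m * trace_cubed Q)"
    by (simp add: power2_eq_square power3_eq_cube mult_ac)
  then have "?m * ?m ^ 3 \<le> ?m * trace_cubed Q" using t by simp
  then show ?thesis using m0 tr0 by (cases "?m = 0") auto
qed

lemma trace_cubed_eq:
  "complex_of_real (trace_cubed Q)
     = (\<Sum>x\<in>G. \<Sum>y\<in>G. \<Sum>z\<in>G. expsum Q (x - y) * cnj (expsum Q (x - z)) * expsum Q (y - z))"
proof -
  have k: "complex_of_real ((cmod (trace_kernel Q x u))\<^sup>2)
     = (\<Sum>y\<in>G. \<Sum>z\<in>G. expsum Q (x - y) * cnj (expsum Q (x - z)) * chr (u * (y - z)))" for x u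
    unfolding complex_norm_square trace_kernel_def cnj_sum sum_product
    by (intro sum.cong refl) (simp add: right_diff_distrib chr_diff mult_ac)
  have "complex_of_real (trace_cubed Q)
     = (\<Sum>x\<in>G. \<Sum>u\<in>Q. \<Sum>y\<in>G. \<Sum>z\<in>G. expsum Q (x - y) * cnj (expsum Q (x - z)) * chr (u * (y - z)))"
    by (simp only: trace_cubed_def of_real_sum k)
  also have "\<dots> = (\<Sum>x\<in>G. \<Sum>y\<in>G. \<Sum>u\<in>Q. \<Sum>z\<in>G. expsum Q (x - y) * cnj (expsum Q (x - z)) * chr (u * (y - z)))"
    by (intro sum.cong refl sum.swap)
  also have "\<dots> = (\<Sum>x\<in>G. \<Sum>y\<in>G. \<Sum>z\<in>G. \<Sum>u\<in>Q. expsum Q (x - y) * cnj (expsum Q (x - z)) * chr (u * (y - z)))"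
    by (intro sum.cong refl sum.swap)
  finally show ?thesis by (simp add: expsum_def[of Q "_ - _"] flip: sum_distrib_left)
qed

lemma norm_expsum_minus: "cmod (expsum Q (x - y)) = cmod (expsum Q (y - x))"
  using cnj_expsum[of Q "y - x"] complex_mod_cnj[of "expsum Q (y - x)"] by simp

text \<open>Only the differences a = y - x and b = z - x matter in the triple sum. Cauchy-Schwarz
  separates their multiplicities \<open>C\<close>, whose squares sum to \<open>E3 G\<close>, from
  the products \<open>H\<close>, whose squares sum to p^2 times \<open>E3 Q\<close>.\<close>

lemma trace_cubed_le:
  assumes Q: "Q \<subseteq> {0..<int p}"
  shows "(trace_cubed Q)\<^sup>2 \<le> E3 G * (real p ^ 2 * E3 Q)"
proof -
  let ?R = "{0..<int p}"
  define A where "A x = cmod (expsum Q x)" for x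
  define C where "C a b = real (card {x \<in> G. (x + a) mod int p \<in> G \<and> (x + b) mod int p \<in> G})" for a b
  define H where "H a b = A a * A b * A (b - a)" for a b
  have GR: "G \<subseteq> ?R" using G_subset by auto
  have Ac: "A a = A b" if "[a = b] (mod int p)" for a b
    unfolding A_def using expsum_cong[OF that] by simp
  have tr0: "trace_cubed Q \<ge> 0" by (simp add: trace_cubed_def sum_nonneg)
  have "trace_cubed Q = cmod (complex_of_real (trace_cubed Q))" using tr0 by simp
  also have "\<dots> \<le> (\<Sum>x\<in>G. \<Sum>y\<in>G. \<Sum>z\<in>G. H (y - x) (z - x))"
    unfolding trace_cubed_eq
  proof (intro sum_norm_le)
    fix x y z
    show "cmod (expsum Q (x - y) * cnj (expsum Q (x - z)) * expsum Q (y - z)) \<le> H (y - x) (z - x)"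
      using norm_expsum_minus[of Q x y] norm_expsum_minus[of Q x z] norm_expsum_minus[of Q y z]
      by (simp add: H_def A_def norm_mult)
  qed
  also have "\<dots> = (\<Sum>x\<in>G. \<Sum>a\<in>?R. \<Sum>b\<in>?R.
       if (x + a) mod int p \<in> G \<and> (x + b) mod int p \<in> G then H a b else 0)"
  proof (rule sum.cong[OF refl])
    fix x assume "x \<in> G"
    have "(\<Sum>y\<in>G. \<Sum>z\<in>G. H (y - x) (z - x))
        = (\<Sum>a\<in>?R. if (x + a) mod int p \<in> G then (\<Sum>z\<in>G. H a (z - x)) else 0)"
      by (rule sum_subset_shift[OF GR, of "\<lambda>a. \<Sum>z\<in>G. H a (z - x)"])
        (auto simp: H_def intro!: sum.cong arg_cong2[of _ _ _ _ "(*)"] Ac cong_diff)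
    also have "\<dots> = (\<Sum>a\<in>?R. if (x + a) mod int p \<in> G
        then (\<Sum>b\<in>?R. if (x + b) mod int p \<in> G then H a b else 0) else 0)"
    proof (rule sum.cong[OF refl], rule if_cong[OF refl _ refl])
      fix a
      show "(\<Sum>z\<in>G. H a (z - x)) = (\<Sum>b\<in>?R. if (x + b) mod int p \<in> G then H a b else 0)"
        by (rule sum_subset_shift[OF GR, of "\<lambda>b. H a b"])
          (auto simp: H_def intro!: arg_cong2[of _ _ _ _ "(*)"] Ac cong_diff)
    qed
    also have "\<dots> = (\<Sum>a\<in>?R. \<Sum>b\<in>?R.
       if (x + a) mod int p \<in> G \<and> (x + b) mod int p \<in> G then H a b else 0)"
      by (intro sum.cong refl) auto
    finally show "(\<Sum>y\<in>G. \<Sum>z\<in>G. H (y - x) (z - x)) = (\<Sum>a\<in>?R. \<Sum>b\<in>?R.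
       if (x + a) mod int p \<in> G \<and> (x + b) mod int p \<in> G then H a b else 0)" .
  qed
  also have "\<dots> = (\<Sum>a\<in>?R. \<Sum>b\<in>?R. \<Sum>x\<in>G.
       if (x + a) mod int p \<in> G \<and> (x + b) mod int p \<in> G then H a b else 0)"
    by (rule trans[OF sum.swap sum.cong[OF refl sum.swap]])
  also have "\<dots> = (\<Sum>a\<in>?R. \<Sum>b\<in>?R. C a b * H a b)"
    unfolding C_def using finite_G by (intro sum.cong refl) (simp add: sum.If_cases Int_def)
  also have "\<dots> = (\<Sum>(a, b)\<in>?R \<times> ?R. C a b * H a b)" by (simp add: sum.cartesian_product)
  finally have "(trace_cubed Q)\<^sup>2 \<le> (\<Sum>(a, b)\<in>?R \<times> ?R. C a b * H a b)\<^sup>2"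
    using tr0 by (intro power_mono)
  also have "\<dots> \<le> (\<Sum>(a, b)\<in>?R \<times> ?R. (C a b)\<^sup>2) * (\<Sum>(a, b)\<in>?R \<times> ?R. (H a b)\<^sup>2)"
    using Cauchy_Schwarz_ineq_sum[of "\<lambda>(a, b). C a b" "\<lambda>(a, b). H a b" "?R \<times> ?R"]
    by (simp add: case_prod_unfold)
  also have "(\<Sum>(a, b)\<in>?R \<times> ?R. (C a b)\<^sup>2) = E3 G"
    using sum_triple_corr by (simp add: C_def sum.cartesian_product[symmetric])
  also have "(\<Sum>(a, b)\<in>?R \<times> ?R. (H a b)\<^sup>2) = real p ^ 2 * E3 Q"
    using sum_norm_expsum_triple[OF Q]
    by (simp add: H_def A_def power_mult_distrib sum.cartesian_product[symmetric])
  finally show ?thesis .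
qed

lemma expsum_trace_inequality:
  assumes Q: "invariant Q"
  shows "(\<Sum>u\<in>Q. (cmod (expsum G u))\<^sup>2) ^ 6 \<le> real t ^ 6 * real p ^ 2 * E3 G * E3 Q"
proof -
  have "mean_sq Q ^ 3 \<ge> 0" by (simp add: mean_sq_def sum_nonneg)
  then have "(mean_sq Q ^ 3)\<^sup>2 \<le> (trace_cubed Q)\<^sup>2"
    using mean_sq_cubed_le_trace[OF Q] by (intro power_mono)
  also have "\<dots> \<le> E3 G * (real p ^ 2 * E3 Q)"
    using invariantD(2)[OF Q] by (intro trace_cubed_le) auto
  finally have "mean_sq Q ^ 6 \<le> E3 G * (real p ^ 2 * E3 Q)" by (simp flip: power_mult)
  then show ?thesis using t_pos
    by (simp add: mean_sq_def power_divide field_simps)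
qed

lemma additive_energy_eq: "real (additive_energy p G) = (\<Sum>z\<in>{0..<int p}. real (autocorr G z) ^ 2)"
proof -
  have GR: "G \<subseteq> {0..<int p}" using G_subset by auto
  let ?S = "SIGMA a2:G. SIGMA a1:G. {b1 \<in> G. (b1 + (a1 - a2)) mod int p \<in> G}"
  let ?E = "{(a1, a2, b1, b2). a1 \<in> G \<and> a2 \<in> G \<and> b1 \<in> G \<and> b2 \<in> G \<and>
             a1 \<oplus>\<^bsub>GFp p\<^esub> b1 = a2 \<oplus>\<^bsub>GFp p\<^esub> b2}"
  have iff: "(a1 + b1) mod int p = (a2 + b2) mod int p \<longleftrightarrow> b2 = (b1 + (a1 - a2)) mod int p" if "b2 \<in> G" for a1 a2 b1 b2
  proof -
    have "b2 mod int p = b2" using that GR by (intro mod_pos_pos_trivial) auto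
    moreover have "(a1 + b1) mod int p = (a2 + b2) mod int p \<longleftrightarrow> b2 mod int p = (b1 + (a1 - a2)) mod int p"
      unfolding mod_eq_dvd_iff by (subst dvd_minus_iff[symmetric]) (simp add: algebra_simps)
    ultimately show ?thesis by metis
  qed
  have "bij_betw (\<lambda>(a1, a2, b1, b2). (a2, a1, b1)) ?E ?S"
    by (rule bij_betw_byWitness[where f' = "\<lambda>(a2, a1, b1). (a1, a2, b1, (b1 + (a1 - a2)) mod int p)"])
      (auto simp: residue_ring_def iff)
  then have "additive_energy p G = card ?S"
    unfolding additive_energy_def by (rule bij_betw_same_card)
  also have "\<dots> = (\<Sum>a2\<in>G. \<Sum>a1\<in>G. autocorr G (a1 - a2))"
    using finite_G by (simp add: autocorr_def)
  also have "\<dots> = (\<Sum>z\<in>{0..<int p}. autocorr G z * autocorr G z)"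
    using sum_differences[OF GR, of "autocorr G"] autocorr_cong[of _ _ G] by auto
  finally show ?thesis by (simp add: power2_eq_square)
qed

section \<open>Moments of the exponential sums\<close>

lemma conv_G_eq: "conv G = autocorr G"
  by (rule ext) (simp add: conv_def autocorr_def)

text \<open>For Q = G the secondary terms are t^2 and t^6 / p^2, and t^3 \<le> p^2 puts both below
  t^3.\<close>

lemma E3_G_le:
  assumes tp: "t ^ 3 \<le> p\<^sup>2"
  shows "E3 G \<le> 393216 * (real t ^ 3 * (1 + 2 * ln (real t)))"
proof -
  let ?t = "real t" and ?p = "real p"
  have t: "?t \<ge> 1" using t_pos by simp
  have p: "?p > 0" using p_gt_0 by simp
  have tp': "?t ^ 3 \<le> ?p ^ 2" using tp by (metis of_nat_le_iff of_nat_power)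
  have lt: "ln ?t \<ge> 0" using t by simp
  have "G \<noteq> {}" using one_in_G by auto
  then have "E3 G \<le> 131072 * (?t * ?t ^ 2 * (1 + ln ?t + ln ?t) + ?t ^ 3 / ?t + ?t ^ 3 * ?t ^ 3 / ?p ^ 2)"
    using sum_conv_cubed[OF invariant_G _ tp] by (simp add: E3_def conv_G_eq)
  moreover have "?t * ?t ^ 2 = ?t ^ 3" by (simp add: power2_eq_square power3_eq_cube)
  moreover have "?t ^ 3 / ?t \<le> ?t ^ 3 * (1 + 2 * ln ?t)"
  proof -
    have "?t ^ 3 / ?t \<le> ?t ^ 3 * 1" using t by (simp add: divide_le_eq)
    also have "\<dots> \<le> ?t ^ 3 * (1 + 2 * ln ?t)" using lt t by (intro mult_left_mono) auto
    finally show ?thesis .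
  qed
  moreover have "?t ^ 3 * ?t ^ 3 / ?p ^ 2 \<le> ?t ^ 3 * (1 + 2 * ln ?t)"
  proof -
    have "?t ^ 3 * ?t ^ 3 / ?p ^ 2 \<le> ?t ^ 3 * ?p ^ 2 / ?p ^ 2"
      using tp' by (intro divide_right_mono mult_left_mono) auto
    also have "\<dots> = ?t ^ 3 * 1" using p by simp
    also have "\<dots> \<le> ?t ^ 3 * (1 + 2 * ln ?t)" using lt t by (intro mult_left_mono) auto
    finally show ?thesis .
  qed
  ultimately show ?thesis by (simp only: ring_distribs)
qed

text \<open>The trace inequality has q^6 on the left, and the bound for \<open>E3 Q\<close> supplies
  q^5, which cancels and leaves one power of q. The constant 393216 * 131072 = 3 * 2^34 is rounded
  up to 2^36.\<close>

lemma superlevel_bound: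
  assumes Q: "invariant Q" "Q \<noteq> {}" and tp: "t ^ 3 \<le> p\<^sup>2"
    and tau: "\<tau> \<ge> 0" "\<And>u. u \<in> Q \<Longrightarrow> \<tau> \<le> cmod (expsum G u)"
    and Lam: "1 + ln (real t) + ln (real (card Q)) \<le> Lam"
  shows "\<tau> ^ 12 * real (card Q)
    \<le> 2 ^ 36 * Lam * (real t ^ 7 * real p ^ 2 * Lam + (real t ^ 5 * real p ^ 2 + real t ^ 9) * real (card Q))"
proof -
  let ?t = "real t" and ?p = "real p" and ?q = "real (card Q)"
  have q: "?q \<ge> ?t" using t_le_card_invariant[OF Q] by simp
  have t: "?t \<ge> 1" using t_pos by simp
  have p: "?p > 0" using p_gt_0 by simp
  have lt: "ln ?t \<ge> 0" "ln ?q \<ge> ln ?t" using t q by auto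
  have L1: "Lam \<ge> 1" "1 + 2 * ln ?t \<le> Lam" using lt Lam by auto
  have "\<tau>\<^sup>2 * ?q \<le> (\<Sum>u\<in>Q. (cmod (expsum G u))\<^sup>2)"
    using sum_bounded_below[of Q "\<tau>\<^sup>2" "\<lambda>u. (cmod (expsum G u))\<^sup>2"] tau
    by (simp add: power_mono mult.commute)
  then have "(\<tau>\<^sup>2 * ?q) ^ 6 \<le> (\<Sum>u\<in>Q. (cmod (expsum G u))\<^sup>2) ^ 6"
    by (intro power_mono) auto
  also have "\<dots> \<le> ?t ^ 6 * ?p ^ 2 * E3 G * E3 Q" by (rule expsum_trace_inequality[OF Q(1)])
  also have "\<dots> \<le> ?t ^ 6 * ?p ^ 2 * (393216 * (?t ^ 3 * Lam)) * E3 Q"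
  proof -
    have "E3 G \<le> 393216 * (?t ^ 3 * Lam)"
      using E3_G_le[OF tp] L1(2) t by (smt (verit) mult_left_mono zero_le_power)
    moreover have "E3 Q \<ge> 0" by (simp add: E3_def sum_nonneg)
    ultimately show ?thesis by (intro mult_right_mono mult_left_mono) auto
  qed
  also have "\<dots> = 393216 * ?t ^ 6 * ?p ^ 2 * Lam * (?t ^ 3 * E3 Q)" by simp
  also have "\<dots> \<le> 393216 * ?t ^ 6 * ?p ^ 2 * Lam * (?q ^ 3 * (131072 * (?t * ?q ^ 2 * Lam
          + ?q ^ 3 / ?t + ?q ^ 3 * ?t ^ 3 / ?p ^ 2)))"
  proof -
    have "?t ^ 3 * E3 Q \<le> ?q ^ 3 * (131072 * (?t * ?q ^ 2 * (1 + ln ?t + ln ?q)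
          + ?q ^ 3 / ?t + ?q ^ 3 * ?t ^ 3 / ?p ^ 2))"
      unfolding E3_def by (rule sum_autocorr_cubed[OF Q tp])
    also have "\<dots> \<le> ?q ^ 3 * (131072 * (?t * ?q ^ 2 * Lam + ?q ^ 3 / ?t + ?q ^ 3 * ?t ^ 3 / ?p ^ 2))"
      using Lam t q by (intro mult_left_mono add_mono) auto
    finally show ?thesis using L1 t by (intro mult_left_mono) auto
  qed
  also have "\<dots> = ?q ^ 5 * (51539607552 * Lam * (?t ^ 7 * ?p ^ 2 * Lam + (?t ^ 5 * ?p ^ 2 + ?t ^ 9) * ?q))"
  proof -
    have "?q ^ 3 / ?t = ?q ^ 3 * ?t ^ 5 / ?t ^ 6" using t by (simp add: field_simps eval_nat_numeral)
    then show ?thesis using t p by (simp add: field_simps eval_nat_numeral)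
  qed
  also have "\<dots> \<le> ?q ^ 5 * (2 ^ 36 * Lam * (?t ^ 7 * ?p ^ 2 * Lam + (?t ^ 5 * ?p ^ 2 + ?t ^ 9) * ?q))"
    using L1 t by (intro mult_left_mono mult_right_mono) auto
  finally have "?q ^ 5 * (\<tau> ^ 12 * ?q) \<le> ?q ^ 5 * (2 ^ 36 * Lam * (?t ^ 7 * ?p ^ 2 * Lam + (?t ^ 5 * ?p ^ 2 + ?t ^ 9) * ?q))"
    by (simp add: power_mult_distrib eval_nat_numeral mult_ac)
  then show ?thesis using q t by (simp only: mult_le_cancel_left_pos zero_less_power)
qed

lemma invariant_superlevel: "invariant {u \<in> {1..<int p}. \<tau> \<le> cmod (expsum G u)}"
  unfolding invariant_def
proof (intro conjI ballI)
  fix x u assume x: "x \<in> G" and u: "u \<in> {u \<in> {1..<int p}. \<tau> \<le> cmod (expsum G u)}"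
  then have "x * u mod int p \<in> {1..<int p}"
    using invariantD(2)[OF invariant_orbit[of u]] by auto
  moreover have "expsum G (x * u mod int p) = expsum G (x * u)"
    by (rule expsum_cong) (simp add: cong_def)
  ultimately show "x * u mod int p \<in> {u \<in> {1..<int p}. \<tau> \<le> cmod (expsum G u)}"
    using u expsum_mult_G[OF invariant_G x] by simp
qed auto

text \<open>The exponential sum is constant on the coset of \<xi>, so
  \<open>superlevel_bound\<close> applies to this coset, with q = t. The constant 16 is a convenient
  bound for the twelfth root of 15 * 2^36.\<close>

lemma expsum_le:
  assumes tp: "t ^ 3 \<le> p\<^sup>2" and t2: "t \<ge> 2" and x: "\<xi> \<in> {1..<int p}"
  shows "cmod (expsum G \<xi>) \<le> 16 * real t powr (1/2) * real p powr (1/6) * log 2 (real t) powr (1/6)"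
proof -
  let ?t = "real t" and ?p = "real p" and ?L = "log 2 (real t)" and ?\<tau> = "cmod (expsum G \<xi>)"
  let ?Q = "(\<lambda>x. x * \<xi> mod int p) ` G"
  have L: "?L \<ge> 1" using t2 by simp
  have t: "?t \<ge> 1" "?t > 0" using t2 by auto
  have p: "?p \<ge> 1" using prime_ge_1_nat[OF prime_p] by simp
  have cQ: "card ?Q = t" by (rule card_orbit[OF x])
  have lt: "ln ?t \<le> ?L" by (rule log2_ge_ln[OF t(1)])
  have "?\<tau> ^ 12 * real (card ?Q)
      \<le> 2 ^ 36 * (3 * ?L) * (?t ^ 7 * ?p ^ 2 * (3 * ?L) + (?t ^ 5 * ?p ^ 2 + ?t ^ 9) * real (card ?Q))"
  proof (rule superlevel_bound[OF invariant_orbit[OF x] _ tp])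
    show "?Q \<noteq> {}" using one_in_G by auto
    show "?\<tau> \<le> cmod (expsum G u)" if u: "u \<in> ?Q" for u
    proof -
      obtain y where y: "y \<in> G" "u = y * \<xi> mod int p" using u by auto
      have "expsum G u = expsum G (y * \<xi>)" unfolding y(2) by (rule expsum_cong) (simp add: cong_def)
      then show ?thesis using expsum_mult_G[OF invariant_G y(1)] by simp
    qed
    show "1 + ln ?t + ln (real (card ?Q)) \<le> 3 * ?L" unfolding cQ using lt L by simp
  qed simp
  then have "?\<tau> ^ 12 * ?t \<le> (2 ^ 36 * (3 * ?L) * (?t ^ 6 * ?p ^ 2 * (3 * ?L) + ?t ^ 5 * ?p ^ 2 + ?t ^ 9)) * ?t"
    unfolding cQ by (simp add: eval_nat_numeral algebra_simps)
  then have "?\<tau> ^ 12 \<le> 2 ^ 36 * (3 * ?L) * (?t ^ 6 * ?p ^ 2 * (3 * ?L) + ?t ^ 5 * ?p ^ 2 + ?t ^ 9)"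
    using t by simp
  also have "\<dots> \<le> 2 ^ 36 * (3 * ?L) * (?t ^ 6 * ?p ^ 2 * (3 * ?L) + ?t ^ 6 * ?p ^ 2 * ?L + ?t ^ 6 * ?p ^ 2 * ?L)"
  proof -
    have "?t ^ 5 * ?p ^ 2 * 1 \<le> ?t ^ 6 * ?p ^ 2 * ?L"
      using t L p by (intro mult_mono power_increasing) auto
    moreover have "?t ^ 6 * ?t ^ 3 * 1 \<le> ?t ^ 6 * ?p ^ 2 * ?L"
    proof -
      have "?t ^ 3 \<le> ?p ^ 2" using tp by (metis of_nat_le_iff of_nat_power)
      then show ?thesis using t L by (intro mult_mono) auto
    qed
    ultimately show ?thesis using L by (intro mult_left_mono add_mono) (auto simp flip: power_add)
  qed
  also have "\<dots> = 2 ^ 36 * 15 * (?t ^ 6 * ?p ^ 2 * ?L ^ 2)" by (simp add: power2_eq_square algebra_simps)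
  also have "\<dots> \<le> 16 ^ 12 * (?t ^ 6 * ?p ^ 2 * ?L ^ 2)" using L by (intro mult_right_mono) auto
  also have "\<dots> = (16 * ?t powr (1/2) * ?p powr (1/6) * ?L powr (1/6)) ^ 12"
  proof -
    have "(x powr (1/2)) ^ 12 = x ^ 6" "(x powr (1/6)) ^ 12 = x ^ 2" if "x > 0" for x :: real
      using that by (simp_all add: powr_power)
    then have "(?t powr (1/2)) ^ 12 = ?t ^ 6" "(?p powr (1/6)) ^ 12 = ?p ^ 2" "(?L powr (1/6)) ^ 12 = ?L ^ 2"
      using t p L by (meson less_le_trans zero_less_one)+
    then show ?thesis by (simp only: power_mult_distrib mult.assoc)
  qed
  finally show ?thesis
    by (rule power_mono_iff[THEN iffD1, rotated 3]) auto
qed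

text \<open>The energy is the second moment of the autocorrelation, so its square is at most the
  first moment, t^2, times the third.\<close>

lemma additive_energy_sq_le:
  assumes tp: "t ^ 3 \<le> p\<^sup>2" and t2: "t \<ge> 2"
  shows "real (additive_energy p G) ^ 2 \<le> 1179648 * real t ^ 5 * log 2 (real t)"
proof -
  let ?t = "real t" and ?k = "\<lambda>z. real (autocorr G z)" and ?R = "{0..<int p}"
  have t: "?t \<ge> 1" using t2 by simp
  have L: "log 2 ?t \<ge> 1" using t2 by simp
  have "real (additive_energy p G) = (\<Sum>z\<in>?R. sqrt (?k z) * (?k z * sqrt (?k z)))"
    unfolding additive_energy_eq
    by (intro sum.cong refl) (simp add: power2_eq_square)
  also have "\<dots> ^ 2 \<le> (\<Sum>z\<in>?R. (sqrt (?k z))\<^sup>2) * (\<Sum>z\<in>?R. (?k z * sqrt (?k z))\<^sup>2)"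
    by (rule Cauchy_Schwarz_ineq_sum)
  also have "\<dots> = (\<Sum>z\<in>?R. ?k z) * E3 G"
  proof -
    have "(?k z * sqrt (?k z))\<^sup>2 = ?k z ^ 3" for z
      by (simp add: power_mult_distrib) (simp add: power2_eq_square power3_eq_cube)
    then show ?thesis by (simp add: E3_def)
  qed
  also have "\<dots> \<le> ?t ^ 2 * (393216 * (?t ^ 3 * (3 * log 2 ?t)))"
  proof (rule mult_mono)
    have "real (\<Sum>z\<in>?R. conv G z) \<le> real (t * t)"
      unfolding of_nat_le_iff using sum_conv_total[of G] G_subset by fastforce
    then show "(\<Sum>z\<in>?R. ?k z) \<le> ?t ^ 2" by (simp add: conv_G_eq power2_eq_square)
    have "1 + 2 * ln ?t \<le> 3 * log 2 ?t" using log2_ge_ln[OF t] L by simp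
    then have "393216 * (?t ^ 3 * (1 + 2 * ln ?t)) \<le> 393216 * (?t ^ 3 * (3 * log 2 ?t))"
      using t by (intro mult_left_mono) auto
    then show "E3 G \<le> 393216 * (?t ^ 3 * (3 * log 2 ?t))" using E3_G_le[OF tp] by simp
    show "0 \<le> E3 G" by (simp add: E3_def sum_nonneg)
  qed simp
  also have "\<dots> = 1179648 * ?t ^ 5 * log 2 ?t" by (simp flip: power_add)
  finally show ?thesis .
qed

text \<open>Large values are interpolated between the twelfth and the fourth powers and summed by
  rank. For the others, 32/5 = 12/5 + 4, where f^(12/5) is at most D^(1/5) and the fourth powers sum
  to at most pE.\<close>

lemma sum_expsum_powr_le:
  assumes tp: "t ^ 3 \<le> p\<^sup>2"
  defines "Lam \<equiv> 1 + ln (real t) + ln (real p)"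
  defines "E \<equiv> real (additive_energy p G)"
  shows "(\<Sum>u\<in>{1..<int p}. cmod (expsum G u) powr (32/5))
     \<le> (2 ^ 37 * Lam ^ 2 * real t ^ 7 * real p ^ 2) powr (3/10) * (real p * E) powr (7/10) * Lam
      + (2 ^ 37 * Lam * (real t ^ 5 * real p ^ 2 + real t ^ 9)) powr (1/5) * (real p * E)"
proof -
  let ?t = "real t" and ?p = "real p" and ?R = "{1..<int p}"
  define f where "f u = cmod (expsum G u)" for u
  define A where "A = 2 ^ 37 * Lam ^ 2 * ?t ^ 7 * ?p ^ 2"
  define D where "D = 2 ^ 37 * Lam * (?t ^ 5 * ?p ^ 2 + ?t ^ 9)"
  have t: "?t \<ge> 1" using t_pos by simp
  have p: "?p \<ge> 1" using prime_gt_0_nat[OF prime_p] by simp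
  have f0: "f u \<ge> 0" for u by (simp add: f_def)
  have Lam1: "Lam \<ge> 1" using t p by (simp add: Lam_def)
  have D0: "D > 0" using Lam1 t p by (simp add: D_def add_pos_pos)
  have pE: "(\<Sum>u\<in>{0..<int p}. f u ^ 4) = ?p * E"
    unfolding f_def E_def additive_energy_eq
    by (rule sum_norm_expsum_fourth) (use G_subset in auto)
  have four: "(\<Sum>u\<in>S. f u ^ 4) \<le> ?p * E" if "S \<subseteq> ?R" for S
    unfolding pE[symmetric] using that by (intro sum_mono2) (auto simp: f0)
  \<comment> \<open>On H the term of \<open>superlevel_bound\<close> that is linear in |Q| is at
    most half of the left side and can be absorbed; hence the constant 2^37, twice the one
    there.\<close>
  define H where "H = {u \<in> ?R. D < f u ^ 12}"
  define B where "B = {u \<in> ?R. f u ^ 12 \<le> D}"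
  have fins: "finite H" "finite B" by (auto simp: H_def B_def intro: finite_subset[of _ ?R])
  have low: "(\<Sum>u\<in>B. f u powr (32/5)) \<le> D powr (1/5) * (?p * E)"
  proof -
    have "(\<Sum>u\<in>B. f u powr (32/5)) \<le> (\<Sum>u\<in>B. D powr (1/5) * f u ^ 4)"
    proof (rule sum_mono)
      fix u assume u: "u \<in> B"
      show "f u powr (32/5) \<le> D powr (1/5) * f u ^ 4"
      proof (cases "f u = 0")
        case False
        then have fu: "f u > 0" using f0[of u] by simp
        have "f u powr (32/5) = f u powr (12/5) * f u powr 4"
          unfolding powr_add[symmetric] by simp
        also have "\<dots> = (f u ^ 12) powr (1/5) * f u ^ 4"
          using fu by (simp add: power_powr)
        also have "\<dots> \<le> D powr (1/5) * f u ^ 4"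
          using u by (intro mult_right_mono powr_mono2) (auto simp: B_def f0)
        finally show ?thesis .
      qed simp
    qed
    also have "\<dots> = D powr (1/5) * (\<Sum>u\<in>B. f u ^ 4)" by (simp add: sum_distrib_left)
    also have "\<dots> \<le> D powr (1/5) * (?p * E)" by (intro mult_left_mono four) (auto simp: B_def)
    finally show ?thesis .
  qed
  have high: "(\<Sum>u\<in>H. f u powr (32/5)) \<le> A powr (3/10) * (?p * E) powr (7/10) * Lam"
  proof (cases "H = {}")
    case True
    then show ?thesis using Lam1 by simp
  next
    case False
    have "(\<Sum>u\<in>H. f u powr (32/5)) \<le> A powr (3/10) * (?p * E) powr (7/10) * (1 + ln (real (card H)))"
    proof (rule sum_le_by_rank[OF fins(1) False])
      fix u assume u: "u \<in> H"
      then have fu: "f u > 0" using D0 f0[of u] by (cases "f u = 0") (auto simp: H_def)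
      define Q where "Q = {w \<in> ?R. f u \<le> f w}"
      let ?q = "real (card Q)"
      have uQ: "u \<in> Q" using u by (simp add: Q_def H_def)
      have Q: "invariant Q" using invariant_superlevel[of "f u"] by (simp add: Q_def f_def)
      have finQ: "finite Q" by (rule invariantD(1)[OF Q])
      have q: "?q > 0" using uQ finQ by (auto simp: card_gt_0_iff)
      have qp: "?q \<le> ?p"
      proof -
        have "card Q \<le> card {0..<int p}" by (rule card_mono) (auto simp: Q_def)
        then show ?thesis by simp
      qed
      have "f u ^ 12 * ?q \<le> 2 ^ 36 * Lam * (?t ^ 7 * ?p ^ 2 * Lam + (?t ^ 5 * ?p ^ 2 + ?t ^ 9) * ?q)"
      proof (rule superlevel_bound[OF Q _ tp f0])
        show "f u \<le> cmod (expsum G w)" if "w \<in> Q" for w using that by (simp add: Q_def f_def)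
        show "1 + ln ?t + ln ?q \<le> Lam" using q qp by (simp add: Lam_def)
      qed (use uQ in auto)
      also have "\<dots> = A / 2 + D * ?q / 2" by (simp add: A_def D_def power2_eq_square algebra_simps)
      also have "\<dots> \<le> A / 2 + f u ^ 12 * ?q / 2" using u q by (simp add: H_def)
      finally have fA: "f u ^ 12 * ?q \<le> A" by simp
      have "f u ^ 4 * ?q \<le> (\<Sum>w\<in>Q. f w ^ 4)"
        using sum_bounded_below[of Q "f u ^ 4" "\<lambda>w. f w ^ 4"] f0
        by (simp add: Q_def power_mono mult.commute)
      also have "\<dots> \<le> ?p * E" by (rule four) (auto simp: Q_def)
      finally have fE: "f u ^ 4 * ?q \<le> ?p * E" .
      have "card {w \<in> H. f u powr (32/5) \<le> f w powr (32/5)} \<le> card Q"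
      proof (rule card_mono[OF finQ], safe)
        fix w assume w: "w \<in> H" "f u powr (32/5) \<le> f w powr (32/5)"
        then have "f u \<le> f w" using powr_less_mono2[of "32/5" "f w" "f u"] f0[of w] by fastforce
        then show "w \<in> Q" using w by (simp add: Q_def H_def)
      qed
      then have "f u powr (32/5) * real (card {w \<in> H. f u powr (32/5) \<le> f w powr (32/5)}) \<le> f u powr (32/5) * ?q"
        by (intro mult_left_mono) auto
      also have "\<dots> = (f u ^ 12 * ?q) powr (3/10) * (f u ^ 4 * ?q) powr (7/10)"
      proof -
        have "(f u ^ 12 * ?q) powr (3/10) * (f u ^ 4 * ?q) powr (7/10)
          = (f u powr (18/5) * f u powr (14/5)) * (?q powr (3/10) * ?q powr (7/10))"
          using fu q by (simp add: powr_mult power_powr)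
        also have "\<dots> = f u powr (32/5) * ?q" using q unfolding powr_add[symmetric] by simp
        finally show ?thesis by simp
      qed
      also have "\<dots> \<le> A powr (3/10) * (?p * E) powr (7/10)"
        by (rule mult_mono[OF powr_mono2[OF _ _ fA] powr_mono2[OF _ _ fE]]) (auto simp: f0)
      finally show "f u powr (32/5) * real (card {w \<in> H. f u powr (32/5) \<le> f w powr (32/5)})
        \<le> A powr (3/10) * (?p * E) powr (7/10)" .
    qed simp
    also have "\<dots> \<le> A powr (3/10) * (?p * E) powr (7/10) * Lam"
    proof -
      have "card H \<le> card {0..<int p}" by (rule card_mono) (auto simp: H_def)
      then have "real (card H) \<le> ?p" by simp
      moreover have "real (card H) > 0" using False fins by (simp add: card_gt_0_iff)
      ultimately have "ln (real (card H)) \<le> ln ?p" by simp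
      then have "1 + ln (real (card H)) \<le> Lam" using t by (simp add: Lam_def add_increasing)
      then show ?thesis by (intro mult_left_mono) auto
    qed
    finally show ?thesis .
  qed
  have "?R = H \<union> B" "H \<inter> B = {}" by (auto simp: H_def B_def)
  then have "(\<Sum>u\<in>?R. f u powr (32/5)) = (\<Sum>u\<in>H. f u powr (32/5)) + (\<Sum>u\<in>B. f u powr (32/5))"
    using fins by (simp add: sum.union_disjoint)
  then show ?thesis using low high unfolding f_def A_def D_def by simp
qed

text \<open>The lower bound on the energy in \<open>hyp\<close> does more than compare powers: it
  makes t at least 2 and p at most a power of t up to a constant, so that ln p, which comes from
  summing by rank, may be replaced by log t.\<close>

lemma sum_expsum_powr_bound:
  assumes tp: "t ^ 3 \<le> p\<^sup>2" and K: "K > 0"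
    and hyp: "real p ^ 10 \<le> K * real t ^ 22 * real (additive_energy p G) ^ 2 * log 2 (real t) ^ 9"
  shows "(\<Sum>u\<in>{1..<int p}. cmod (expsum G u) powr (32/5))
     \<le> 3 * exp (100 * (1 + ln (20 + \<bar>ln K\<bar>) + ln 1179648 + \<bar>ln K\<bar>))
        * real t powr (16/5) * real (additive_energy p G) powr (2/5) * real p powr (6/5) * log 2 (real t) powr (9/5)"
proof -
  let ?t = "real t" and ?p = "real p" and ?L = "log 2 (real t)" and ?E = "real (additive_energy p G)"
  let ?Lam = "1 + ln ?t + ln ?p" and ?c = "20 + \<bar>ln K\<bar>"
  have p: "?p > 0" using p_gt_0 by simp
  then have p10: "?p ^ 10 > 0" by simp
  \<comment> \<open>As log 2 1 = 0, the hypothesis would read p^10 \<le> 0.\<close>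
  have "t \<noteq> 1"
  proof
    assume "t = 1"
    then show False using hyp p10 by simp
  qed
  then have t2: "t \<ge> 2" using t_pos by simp
  have "?E \<noteq> 0"
  proof
    assume "?E = 0"
    then show False using hyp p10 by simp
  qed
  then have E: "?E > 0" by simp
  have t: "?t \<ge> 1" using t2 by simp
  have L: "1 \<le> ?L" using t2 by simp
  have Lt: "?L \<le> ?t"
  proof -
    have "t < 2 ^ t" by (rule less_exp)
    then have "?t \<le> 2 ^ t" by (metis less_imp_le of_nat_le_iff of_nat_numeral of_nat_power)
    then have "?t \<le> 2 powr ?t" by (simp add: powr_realpow)
    then show ?thesis using t by (simp add: log_le_iff)
  qed
  have tp': "?t ^ 3 \<le> ?p ^ 2" using tp by (metis of_nat_le_iff of_nat_power)
  note E2 = additive_energy_sq_le[OF tp t2]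
  \<comment> \<open>Inserting the upper bound for the energy into \<open>hyp\<close> bounds p^10 by
    a constant times K t^37.\<close>
  have Lam: "?Lam \<le> ?c * ?L"
  proof -
    have "?p ^ 10 \<le> K * ?t ^ 22 * (1179648 * ?t ^ 5 * ?L) * ?L ^ 9"
      using hyp E2 K L t by (smt (verit) mult_left_mono mult_right_mono zero_le_power mult_nonneg_nonneg)
    also have "\<dots> = (1179648 * K * ?t ^ 27) * ?L ^ 10" by (simp add: eval_nat_numeral)
    also have "\<dots> \<le> (1179648 * K * ?t ^ 27) * ?t ^ 10"
      using L Lt K by (intro mult_left_mono power_mono) auto
    also have "\<dots> = 1179648 * K * ?t ^ 37" by (simp flip: power_add)
    finally have "ln (?p ^ 10) \<le> ln (1179648 * K * ?t ^ 37)" using p K t by (simp add: ln_mono)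
    then have "10 * ln ?p \<le> ln 1179648 + ln K + 37 * ln ?t"
      using p K t by (simp add: ln_mult ln_realpow)
    moreover have "ln (1179648::real) \<le> 21"
    proof -
      have "ln (1179648::real) \<le> ln (2 ^ 21)" by simp
      also have "\<dots> = 21 * ln 2" using ln_realpow[of "2::real" 21] by simp
      also have "\<dots> \<le> 21" using ln_le_minus_one[of "2::real"] by simp
      finally show ?thesis .
    qed
    moreover have "ln ?t \<le> ?L" by (rule log2_ge_ln[OF t])
    moreover have "ln K \<le> \<bar>ln K\<bar>" "0 \<le> \<bar>ln K\<bar>" by auto
    moreover have "\<bar>ln K\<bar> * 1 \<le> \<bar>ln K\<bar> * ?L" using L by (intro mult_left_mono) auto
    ultimately have "?Lam \<le> 20 * ?L + \<bar>ln K\<bar> * ?L" using L by linarith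
    then show ?thesis by (simp add: algebra_simps)
  qed
  have "?Lam > 0" using t p_gt_0 by (simp add: add_pos_nonneg)
  have "(2 ^ 37 * ?Lam ^ 2 * ?t ^ 7 * ?p ^ 2) powr (3/10) * (?p * ?E) powr (7/10) * ?Lam
      + (2 ^ 37 * ?Lam * (?t ^ 5 * ?p ^ 2 + ?t ^ 9)) powr (1/5) * (?p * ?E)
    \<le> 3 * exp (100 * (1 + ln ?c + ln 1179648 + \<bar>ln K\<bar>)) * (?t powr (16/5) * ?E powr (2/5) * ?p powr (6/5) * ?L powr (9/5))"
    by (rule moment_bound_comparison[OF t p E L Lt \<open>?Lam > 0\<close> Lam K _ _ tp' E2 hyp]) auto
  then show ?thesis using sum_expsum_powr_le[OF tp] by (simp add: mult.assoc)
qed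

end

section \<open>Transfer to subgroups of the unit group\<close>

lemma residue_subgroup_of_subgroup:
  assumes p: "prime p" and sub: "subgroup G (units_of (GFp p))"
  shows "residue_subgroup p G"
proof -
  interpret R: residues_prime p "GFp p" by (rule residues_prime.intro[OF p]) simp
  have U: "carrier (units_of (GFp p)) = {x. 0 < x \<and> x < int p \<and> coprime x (int p)}"
    using R.res_units_eq by (simp add: units_of_def)
  have gr: "group (units_of (GFp p))" by (rule R.units_group)
  have one: "\<one>\<^bsub>units_of (GFp p)\<^esub> = 1" by (simp add: units_of_def residue_ring_def)
  have mult: "x \<otimes>\<^bsub>units_of (GFp p)\<^esub> y = x * y mod int p" for x y
    by (simp add: units_of_def residue_ring_def)
  show ?thesis
  proof
    show "prime p" by fact
    show "G \<subseteq> {1..<int p}" using subgroup.subset[OF sub] U by auto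
    show "1 \<in> G" using subgroup.one_closed[OF sub] one by simp
    show "x * y mod int p \<in> G" if "x \<in> G" "y \<in> G" for x y
      using subgroup.m_closed[OF sub that] mult by simp
    show "\<exists>y\<in>G. x * y mod int p = 1" if "x \<in> G" for x
      using subgroup.m_inv_closed[OF sub that] group.r_inv[OF gr, of x] subgroup.mem_carrier[OF sub that]
        mult one by metis
  qed
qed

lemma nonzero_residues: "prime p \<Longrightarrow> carrier (GFp p) - {\<zero>\<^bsub>GFp p\<^esub>} = {1..<int p}"
  by (auto simp: residue_ring_def)

lemma cube_le_square_of_powr:
  assumes "real t \<le> real p powr (2/3)"
  shows "t ^ 3 \<le> p\<^sup>2"
proof (cases "p = 0")
  case False
  have "real t ^ 3 \<le> (real p powr (2/3)) ^ 3" using assms by (intro power_mono) auto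
  also have "\<dots> = real p ^ 2" using False by (simp add: powr_power)
  finally show ?thesis by (metis of_nat_le_iff of_nat_power)
qed (use assms in auto)

text \<open>In the first part the trivial subgroup has to be excluded, because log 2 1 = 0 while its
  exponential sum has modulus 1. In the second part the inequality with K excludes it.\<close>

theorem theorem11:
  shows "(\<exists>C>0. \<forall>(p::nat) (\<Gamma>::int set).
            prime p \<longrightarrow> subgroup \<Gamma> (units_of (GFp p)) \<longrightarrow>
            card \<Gamma> \<ge> 2 \<longrightarrow> real (card \<Gamma>) \<le> real p powr (2/3) \<longrightarrow>
            max_exp_sum p \<Gamma>
              \<le> C * real (card \<Gamma>) powr (1/2) * real p powr (1/6)
                  * log 2 (real (card \<Gamma>)) powr (1/6))
       \<and> (\<forall>K>0. \<exists>C>0. \<forall>(p::nat) (\<Gamma>::int set).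
            prime p \<longrightarrow> subgroup \<Gamma> (units_of (GFp p)) \<longrightarrow>
            real (card \<Gamma>) \<le> real p powr (2/3) \<longrightarrow>
            real p ^ 10 \<le> K * real (card \<Gamma>) ^ 22 * real (additive_energy p \<Gamma>) ^ 2
                            * log 2 (real (card \<Gamma>)) ^ 9 \<longrightarrow>
            (\<Sum>\<xi>\<in>carrier (GFp p) - {\<zero>\<^bsub>GFp p\<^esub>}. cmod (fourier p \<Gamma> \<xi>) powr (32/5))
              \<le> C * real (card \<Gamma>) powr (16/5) * real (additive_energy p \<Gamma>) powr (2/5)
                  * real p powr (6/5) * log 2 (real (card \<Gamma>)) powr (9/5))"
proof
  have "max_exp_sum p \<Gamma> \<le> 16 * real (card \<Gamma>) powr (1/2) * real p powr (1/6)
                  * log 2 (real (card \<Gamma>)) powr (1/6)"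
    if p: "prime p" and sub: "subgroup \<Gamma> (units_of (GFp p))"
      and t2: "card \<Gamma> \<ge> 2" and tp: "real (card \<Gamma>) \<le> real p powr (2/3)" for p \<Gamma>
  proof -
    interpret residue_subgroup p \<Gamma> by (rule residue_subgroup_of_subgroup[OF p sub])
    have e: "(\<Sum>x\<in>\<Gamma>. exp (2 * complex_of_real pi * \<i> * of_int x * of_int \<xi> / of_nat p)) = expsum \<Gamma> \<xi>" for \<xi>
      by (simp add: expsum_def chr_def mult.assoc)
    show ?thesis
      unfolding max_exp_sum_def nonzero_residues[OF p] e
    proof (rule Max.boundedI)
      show "(\<lambda>\<xi>. cmod (expsum \<Gamma> \<xi>)) ` {1..<int p} \<noteq> {}"
        using prime_gt_1_nat[OF p] by auto
    qed (use expsum_le[OF cube_le_square_of_powr[OF tp] t2] in auto)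
  qed
  then show "\<exists>C>0. \<forall>(p::nat) (\<Gamma>::int set).
            prime p \<longrightarrow> subgroup \<Gamma> (units_of (GFp p)) \<longrightarrow>
            card \<Gamma> \<ge> 2 \<longrightarrow> real (card \<Gamma>) \<le> real p powr (2/3) \<longrightarrow>
            max_exp_sum p \<Gamma>
              \<le> C * real (card \<Gamma>) powr (1/2) * real p powr (1/6)
                  * log 2 (real (card \<Gamma>)) powr (1/6)"
    by (intro exI[of _ 16]) auto
next
  have "(\<Sum>\<xi>\<in>carrier (GFp p) - {\<zero>\<^bsub>GFp p\<^esub>}. cmod (fourier p \<Gamma> \<xi>) powr (32/5))
              \<le> (3 * exp (100 * (1 + ln (20 + \<bar>ln K\<bar>) + ln 1179648 + \<bar>ln K\<bar>)))
                  * real (card \<Gamma>) powr (16/5) * real (additive_energy p \<Gamma>) powr (2/5)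
                  * real p powr (6/5) * log 2 (real (card \<Gamma>)) powr (9/5)"
    if K: "K > 0" and p: "prime p" and sub: "subgroup \<Gamma> (units_of (GFp p))"
      and tp: "real (card \<Gamma>) \<le> real p powr (2/3)"
      and hyp: "real p ^ 10 \<le> K * real (card \<Gamma>) ^ 22 * real (additive_energy p \<Gamma>) ^ 2
                            * log 2 (real (card \<Gamma>)) ^ 9" for K p \<Gamma>
  proof -
    interpret residue_subgroup p \<Gamma> by (rule residue_subgroup_of_subgroup[OF p sub])
    \<comment> \<open>The opposite sign in the exponent amounts to conjugation and does not change
      the modulus.\<close>
    have "fourier p \<Gamma> \<xi> = cnj (expsum \<Gamma> \<xi>)" for \<xi>
      unfolding cnj_expsum by (simp add: fourier_def expsum_def chr_def mult.assoc)
    then show ?thesis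
      unfolding nonzero_residues[OF p]
      using sum_expsum_powr_bound[OF cube_le_square_of_powr[OF tp] K hyp] by simp
  qed
  then show "\<forall>K>0. \<exists>C>0. \<forall>(p::nat) (\<Gamma>::int set).
            prime p \<longrightarrow> subgroup \<Gamma> (units_of (GFp p)) \<longrightarrow>
            real (card \<Gamma>) \<le> real p powr (2/3) \<longrightarrow>
            real p ^ 10 \<le> K * real (card \<Gamma>) ^ 22 * real (additive_energy p \<Gamma>) ^ 2
                            * log 2 (real (card \<Gamma>)) ^ 9 \<longrightarrow>
            (\<Sum>\<xi>\<in>carrier (GFp p) - {\<zero>\<^bsub>GFp p\<^esub>}. cmod (fourier p \<Gamma> \<xi>) powr (32/5))
              \<le> C * real (card \<Gamma>) powr (16/5) * real (additive_energy p \<Gamma>) powr (2/5)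
                  * real p powr (6/5) * log 2 (real (card \<Gamma>)) powr (9/5)"
    by (meson exp_gt_zero mult_pos_pos zero_less_numeral)
qed

end
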